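(* Let $\varepsilon_A^{\delta},\varepsilon_B^{\delta}$ ($\delta\ge 0$) be a family of permittivities as in the context, with $\varepsilon_j^{0}$ real-valued (undamped), $\mathrm{Re}(\varepsilon_j^\delta)=\varepsilon_j^0$ for all $\delta$, and $\lim_{\delta\to0}\sup_{x\in\mathbb{R}}|\mathrm{Im}(\varepsilon_j^\delta(x))|=0$ for $j=A,B$. Let $Z^{(U)}$ and $\mathfrak{A}^U$ be the interface impedance and band gap for $\delta=0$, and $Z^{(D)}$ and $\mathfrak{A}^D$ those for $\delta>0$. Assume that $Z^{(U)}$ has a root $\omega_U\in\mathfrak{A}^U\cap\mathfrak{A}^D$ (for small $\delta$). Then, for small $\delta$, $Z^{(D)}$ has a unique root in $\mathfrak{A}^D$ which converges to $\omega_U$ as $\delta\to0$; that is, there is a family of roots $\omega_D(\delta)\in\mathfrak{A}^D$ of $Z^{(D)}$, defined for all sufficiently small $\delta>0$, with $\omega_D(\delta)\to\omega_U$ as $\delta\to0$, and any two such families coincide for all sufficiently small $\delta$.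
   Context: Fix a real constant $\mu_0>0$ and a point $x_0\in\mathbb{R}$. For $j\in\{A,B\}$ and each $\delta$, $\varepsilon_j=\varepsilon_j^\delta:\mathbb{R}\to\mathbb{C}$ is piecewise smooth (finitely many breakpoints per period, with one-sided limits), has $\mathrm{Re}(\varepsilon_j)>0$ (also for one-sided limits), is $1$-periodic, and is inversion symmetric: $\varepsilon_j(x_0+h)=\varepsilon_j(x_0+1-h)$ for $h\in(0,1)$. Put $\mathcal{L}_ju=-\frac{1}{\mu_0}\left(\frac{1}{\varepsilon_j}u'\right)'$; solutions of $\mathcal{L}_ju=\omega^2u$ are understood with $u$ and $\frac{1}{\varepsilon_j}u'$ continuous. The Floquet–Bloch spectrum of material $j$ is the set of $\omega\in\mathbb{C}$ for which there are $\kappa\in[-\pi,\pi]$ and a nonzero solution $u$ of $\mathcal{L}_ju=\omega^2u$ on $\mathbb{R}$ with $u(x+1)=e^{i\kappa}u(x)$ and $u'(x+1)=e^{i\kappa}u'(x)$. The (common) band gap is the set of $\omega\in\mathbb{C}$ lying in neither the Floquet–Bloch spectrum of material $A$ nor that of material $B$; it is denoted $\mathfrak{A}^U$ for $\delta=0$ and $\mathfrak{A}^D$ (depending on $\delta$) for $\delta>0$. For $\omega$ in the common band gap, let $u_A(\cdot,\omega)$ (resp. $u_B(\cdot,\omega)$) be the nonzero solution, unique up to scaling, of $\mathcal{L}_Au=\omega^2u$ (resp. $\mathcal{L}_Bu=\omega^2u$) which decays together with its derivative as $x\to-\infty$ (resp. $x\to+\infty$). The surface impedances are $$Z_A(\omega)=-\frac{u_A(x_0^-,\omega)}{\frac{1}{\varepsilon_A(x_0^-)}u_A'(x_0^-,\omega)},\qquad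 Z_B(\omega)=\frac{u_B(x_0^+,\omega)}{\frac{1}{\varepsilon_B(x_0^+)}u_B'(x_0^+,\omega)},$$ and the interface impedance is $Z(\omega)=Z_A(\omega)+Z_B(\omega)$. *)

theory Defs
  imports "HOL-Analysis.Analysis"
begin

definition smooth_on :: "real set \<Rightarrow> (real \<Rightarrow> complex) \<Rightarrow> bool" where
  "smooth_on U f \<longleftrightarrow>
     (\<forall>n. \<forall>x\<in>U. ((\<lambda>g t. vector_derivative g (at t)) ^^ n) f differentiable (at x))"

text \<open>The set \<open>S\<close> of breakpoints is locally finite, hence closed, so that \<open>- S\<close> is open.\<close>

definition piecewise_smooth :: "(real \<Rightarrow> complex) \<Rightarrow> bool" where
  "piecewise_smooth f \<longleftrightarrow>
     (\<exists>S. (\<forall>a b. finite (S \<inter> {a..b})) \<and> smooth_on (- S) f) \<and>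
     (\<forall>x. (\<exists>l. (f \<longlongrightarrow> l) (at_left x)) \<and> (\<exists>r. (f \<longlongrightarrow> r) (at_right x)))"

definition permittivity :: "real \<Rightarrow> (real \<Rightarrow> complex) \<Rightarrow> bool" where
  "permittivity x0 \<epsilon> \<longleftrightarrow>
     piecewise_smooth \<epsilon> \<and>
     (\<forall>x. Re (\<epsilon> x) > 0) \<and>
     (\<forall>x. Re (Lim (at_left x) \<epsilon>) > 0 \<and> Re (Lim (at_right x) \<epsilon>) > 0) \<and>
     (\<forall>x. \<epsilon> (x + 1) = \<epsilon> x) \<and>
     (\<forall>h\<in>{0<..<1}. \<epsilon> (x0 + h) = \<epsilon> (x0 + 1 - h))"

text \<open>
  The function \<open>v\<close> is the continuous extension of \<open>(1 / \<epsilon>) u'\<close> to the points where \<open>\<epsilon>\<close>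
  jumps; at such a point \<open>u\<close> need not be differentiable, so the differential equation
  is imposed exactly where \<open>\<epsilon>\<close> is continuous.
\<close>

definition is_solution ::
    "real \<Rightarrow> (real \<Rightarrow> complex) \<Rightarrow> complex \<Rightarrow> (real \<Rightarrow> complex) \<Rightarrow> bool" where
  "is_solution \<mu>0 \<epsilon> \<omega> u \<longleftrightarrow>
     continuous_on UNIV u \<and>
     (\<exists>v. continuous_on UNIV v \<and>
        (\<forall>x. isCont \<epsilon> x \<longrightarrow>
           u differentiable (at x) \<and>
           v x = 1 / \<epsilon> x * vector_derivative u (at x) \<and>
           v differentiable (at x) \<and>
           - (1 / complex_of_real \<mu>0) * vector_derivative v (at x) = \<omega>\<^sup>2 * u x))"

definition nonzero_solution ::
    "real \<Rightarrow> (real \<Rightarrow> complex) \<Rightarrow> complex \<Rightarrow> (real \<Rightarrow> complex) \<Rightarrow> bool" where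
  "nonzero_solution \<mu>0 \<epsilon> \<omega> u \<longleftrightarrow> is_solution \<mu>0 \<epsilon> \<omega> u \<and> (\<exists>x. u x \<noteq> 0)"

definition floquet_bloch_spectrum :: "real \<Rightarrow> (real \<Rightarrow> complex) \<Rightarrow> complex set" where
  "floquet_bloch_spectrum \<mu>0 \<epsilon> =
     {\<omega>. \<exists>\<kappa>\<in>{-pi..pi}. \<exists>u. nonzero_solution \<mu>0 \<epsilon> \<omega> u \<and>
        (\<forall>x. u (x + 1) = exp (\<i> * complex_of_real \<kappa>) * u x) \<and>
        (\<forall>x. isCont \<epsilon> x \<longrightarrow>
           vector_derivative u (at (x + 1))
             = exp (\<i> * complex_of_real \<kappa>) * vector_derivative u (at x))}"

definition common_band_gap ::
    "real \<Rightarrow> (real \<Rightarrow> complex) \<Rightarrow> (real \<Rightarrow> complex) \<Rightarrow> complex set" where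
  "common_band_gap \<mu>0 \<epsilon>A \<epsilon>B =
     - floquet_bloch_spectrum \<mu>0 \<epsilon>A \<inter> - floquet_bloch_spectrum \<mu>0 \<epsilon>B"

text \<open>
  Decay of \<open>u\<close> and \<open>u'\<close> along \<open>F\<close> (one of \<open>at_bot\<close>, \<open>at_top\<close>), where \<open>u'\<close> is only
  considered at the points where it is guaranteed to exist.
\<close>

definition decays ::
    "real filter \<Rightarrow> (real \<Rightarrow> complex) \<Rightarrow> (real \<Rightarrow> complex) \<Rightarrow> bool" where
  "decays F \<epsilon> u \<longleftrightarrow>
     (u \<longlongrightarrow> 0) F \<and>
     ((\<lambda>x. vector_derivative u (at x)) \<longlongrightarrow> 0) (inf F (principal {x. isCont \<epsilon> x}))"

text \<open>
  For \<open>\<omega>\<close> in the band gap the decaying solution is unique up to scaling, so the choice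
  made here does not affect the surface impedances.
\<close>

definition decaying_solution ::
    "real filter \<Rightarrow> real \<Rightarrow> (real \<Rightarrow> complex) \<Rightarrow> complex \<Rightarrow> real \<Rightarrow> complex" where
  "decaying_solution F \<mu>0 \<epsilon> \<omega> = (SOME u. nonzero_solution \<mu>0 \<epsilon> \<omega> u \<and> decays F \<epsilon> u)"

text \<open>The one-sided value \<open>(1 / \<epsilon>(x0\<^sup>\<plusminus>)) u'(x0\<^sup>\<plusminus>)\<close>, with \<open>G\<close> being \<open>at_left x0\<close> or \<open>at_right x0\<close>.\<close>

definition one_sided_flux ::
    "real filter \<Rightarrow> (real \<Rightarrow> complex) \<Rightarrow> (real \<Rightarrow> complex) \<Rightarrow> complex" where
  "one_sided_flux G \<epsilon> u = 1 / Lim G \<epsilon> * Lim G (\<lambda>x. vector_derivative u (at x))"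

definition flux_A :: "real \<Rightarrow> real \<Rightarrow> (real \<Rightarrow> complex) \<Rightarrow> complex \<Rightarrow> complex" where
  "flux_A \<mu>0 x0 \<epsilon> \<omega> = one_sided_flux (at_left x0) \<epsilon> (decaying_solution at_bot \<mu>0 \<epsilon> \<omega>)"

definition flux_B :: "real \<Rightarrow> real \<Rightarrow> (real \<Rightarrow> complex) \<Rightarrow> complex \<Rightarrow> complex" where
  "flux_B \<mu>0 x0 \<epsilon> \<omega> = one_sided_flux (at_right x0) \<epsilon> (decaying_solution at_top \<mu>0 \<epsilon> \<omega>)"

definition impedance_A :: "real \<Rightarrow> real \<Rightarrow> (real \<Rightarrow> complex) \<Rightarrow> complex \<Rightarrow> complex" where
  "impedance_A \<mu>0 x0 \<epsilon> \<omega> =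
     - (Lim (at_left x0) (decaying_solution at_bot \<mu>0 \<epsilon> \<omega>) / flux_A \<mu>0 x0 \<epsilon> \<omega>)"

definition impedance_B :: "real \<Rightarrow> real \<Rightarrow> (real \<Rightarrow> complex) \<Rightarrow> complex \<Rightarrow> complex" where
  "impedance_B \<mu>0 x0 \<epsilon> \<omega> =
     Lim (at_right x0) (decaying_solution at_top \<mu>0 \<epsilon> \<omega>) / flux_B \<mu>0 x0 \<epsilon> \<omega>"

definition interface_impedance ::
    "real \<Rightarrow> real \<Rightarrow> (real \<Rightarrow> complex) \<Rightarrow> (real \<Rightarrow> complex) \<Rightarrow> complex \<Rightarrow> complex" where
  "interface_impedance \<mu>0 x0 \<epsilon>A \<epsilon>B \<omega> = impedance_A \<mu>0 x0 \<epsilon>A \<omega> + impedance_B \<mu>0 x0 \<epsilon>B \<omega>"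

text \<open>
  Where a flux vanishes, the corresponding surface impedance is infinite, although
  division by zero yields \<open>0\<close>.  A root of the interface impedance is therefore
  required to be a point at which both surface impedances are finite.
\<close>

definition interface_impedance_root ::
    "real \<Rightarrow> real \<Rightarrow> (real \<Rightarrow> complex) \<Rightarrow> (real \<Rightarrow> complex) \<Rightarrow> complex \<Rightarrow> bool" where
  "interface_impedance_root \<mu>0 x0 \<epsilon>A \<epsilon>B \<omega> \<longleftrightarrow>
     flux_A \<mu>0 x0 \<epsilon>A \<omega> \<noteq> 0 \<and> flux_B \<mu>0 x0 \<epsilon>B \<omega> \<noteq> 0 \<and>
     interface_impedance \<mu>0 x0 \<epsilon>A \<epsilon>B \<omega> = 0"

end

theory Submission
  imports Defs
begin

text \<open>
  Write the equation as the system \<open>u' = \<epsilon> v\<close>, \<open>v' = - \<mu>0 \<omega>\<^sup>2 u\<close>.  Inversion symmetry and periodicity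
  make \<open>\<epsilon>\<close> even about \<open>x0\<close>, so the solution decaying to the left is the reflection of the
  one decaying to the right, and both surface impedances are given by the same function
  \<open>\<zeta>(\<epsilon>, z)\<close> of \<open>z = \<omega>\<^sup>2\<close>: the value of \<open>u / v\<close> at \<open>x0\<close> for the Bloch solution whose multiplier
  \<open>\<rho>\<close> lies inside the unit disc.  Lagrange's identity over one period gives
  \[ \zeta(z_1) - \zeta(z_2) = -(z_1 - z_2) \frac{\mu_0 \int u_1 u_2}{1 - \rho_1 \rho_2}. \]
  The quotient is continuous in the permittivity and in \<open>z\<^sub>1\<close>, \<open>z\<^sub>2\<close>.  At an undamped root, \<open>z\<close> is real
  by self-adjointness, hence so are \<open>u\<close> and \<open>\<rho>\<close>, and the quotient is negative for both materials;
  moreover \<open>\<omega> \<noteq> 0\<close>, as \<open>0\<close> lies in the spectrum.  So a simplified Newton iteration for the interface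
  impedance contracts on a ball around \<open>\<omega>U\<close> that does not depend on the small parameter \<open>\<delta>\<close>.
\<close>

subsection \<open>Solutions of the initial value problem as fixed points\<close>

text \<open>Damping makes \<open>\<epsilon>\<close> complex and destroys self-adjointness, so the
  sign argument fails for \<open>\<delta> > 0\<close>. Even for \<open>\<delta> = 0\<close> the
  integral in the quotient is bilinear, \<open>u1 u2\<close> without conjugation, and gets a sign
  only once \<open>u\<close> is known to be real. The sign is therefore used at a single point, and
  nearby only non-vanishing is kept. Uniqueness has to hold in a ball that does not shrink with
  \<open>\<delta>\<close>; neither pointwise convergence of the impedances nor a nonzero derivative
  at one point would give this. The two-point quotient does: it controls \<open>f w1 - f w2\<close>
  for all pairs in the ball, without any appeal to analyticity in \<open>\<omega>\<close>. The
  factor \<open>w1 + w2\<close>, from \<open>w1^2 - w2^2\<close>, is the price of passing from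
  \<open>z\<close> back to \<open>\<omega>\<close>, and the reason why
  \<open>\<omega> \<noteq> 0\<close> matters. The danger to continuity is the multiplier, a choice
  between two roots; in the gap the other root lies outside the closed unit disc, which separates
  them.\<close>

definition primitive_from :: "real \<Rightarrow> (real \<Rightarrow> complex) \<Rightarrow> real \<Rightarrow> complex" where
  "primitive_from x0 h x = integral {x0..x} h - integral {x..x0} h"

lemma primitive_from_self [simp]: "primitive_from x0 h x0 = 0"
  by (simp add: primitive_from_def)

text \<open>An integral over reversed endpoints is \<open>0\<close>, so
  \<open>primitive_from\<close> is the oriented integral from \<open>x0\<close>; the cases only
  decide which of its two terms survive.\<close>

lemma primitive_from_diff:
  assumes "\<And>a b. h integrable_on {a..b}" and "a \<le> b"
  shows "primitive_from x0 h b - primitive_from x0 h a = integral {a..b} h"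
proof -
  have comb: "integral {p..q} h + integral {q..r} h = integral {p..r} h"
    if "p \<le> q" "q \<le> r" for p q r
    using Henstock_Kurzweil_Integration.integral_combine[OF that assms(1)] .
  consider "x0 \<le> a" | "a \<le> x0" "x0 \<le> b" | "b \<le> x0" by linarith
  then show ?thesis
  proof cases
    case 1
    have "integral {a..x0} h = 0" "integral {b..x0} h = 0"
      using 1 assms(2) by (cases "a = x0"; cases "b = x0"; simp)+
    with comb[OF 1 assms(2)] show ?thesis by (auto simp: primitive_from_def algebra_simps)
  next
    case 2
    have "integral {x0..a} h = 0" "integral {b..x0} h = 0"
      using 2 by (cases "a = x0"; cases "b = x0"; simp)+
    with comb[OF 2] show ?thesis by (auto simp: primitive_from_def algebra_simps)
  next
    case 3
    have "integral {x0..a} h = 0" "integral {x0..b} h = 0"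
      using 3 assms(2) by (cases "a = x0"; cases "b = x0"; simp)+
    with comb[OF assms(2) 3] show ?thesis by (auto simp: primitive_from_def algebra_simps)
  qed
qed

text \<open>Integrated away from \<open>x0\<close>, the weight reproduces itself divided by
  \<open>K\<close>; the contribution \<open>- B / K\<close> of the endpoint \<open>x0\<close> has
  the right sign and is dropped.\<close>

lemma primitive_from_bound:
  assumes int: "\<And>a b. h integrable_on {a..b}" and "K > 0"
    and bnd: "\<And>s. norm (h s) \<le> B * exp (K * \<bar>s - x0\<bar>)"
  shows "norm (primitive_from x0 h x) \<le> B / K * exp (K * \<bar>x - x0\<bar>)"
proof -
  have B: "B \<ge> 0" using order_trans[OF norm_ge_zero bnd[of x0]] by simp
  show ?thesis
  proof (cases "x0 \<le> x")
    case True
    have I: "((\<lambda>s. B * exp (K * (s - x0))) has_integral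
        B / K * exp (K * (x - x0)) - B / K * exp (K * (x0 - x0))) {x0..x}"
      using True \<open>K > 0\<close>
      by (intro fundamental_theorem_of_calculus)
         (auto intro!: derivative_eq_intros simp flip: has_real_derivative_iff_has_vector_derivative)
    have "norm (integral {x0..x} h) \<le> integral {x0..x} (\<lambda>s. B * exp (K * (s - x0)))"
      using bnd I by (intro integral_norm_bound_integral int) (fastforce intro: order_trans)+
    also have "\<dots> = B / K * exp (K * (x - x0)) - B / K"
      unfolding integral_unique[OF I] by simp
    also have "\<dots> \<le> B / K * exp (K * \<bar>x - x0\<bar>)" using True B \<open>K > 0\<close> by simp
    finally show ?thesis using True by (cases "x = x0") (auto simp: primitive_from_def)
  next
    case False
    have I: "((\<lambda>s. B * exp (K * (x0 - s))) has_integral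
        - B / K * exp (K * (x0 - x0)) - (- B / K * exp (K * (x0 - x)))) {x..x0}"
      using False \<open>K > 0\<close>
      by (intro fundamental_theorem_of_calculus)
         (auto intro!: derivative_eq_intros simp flip: has_real_derivative_iff_has_vector_derivative)
    have "norm (integral {x..x0} h) \<le> integral {x..x0} (\<lambda>s. B * exp (K * (x0 - s)))"
    proof (intro integral_norm_bound_integral int)
      show "norm (h s) \<le> B * exp (K * (x0 - s))" if "s \<in> {x..x0}" for s
        using bnd[of s] that by (simp add: abs_minus_commute)
    qed (use I in blast)
    also have "\<dots> = B / K * exp (K * (x0 - x)) - B / K"
      unfolding integral_unique[OF I] by simp
    also have "\<dots> \<le> B / K * exp (K * \<bar>x - x0\<bar>)" using False B \<open>K > 0\<close> by simp
    finally show ?thesis using False by (auto simp: primitive_from_def)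
  qed
qed

lemma integrable_on_interval_bounded:
  fixes h :: "real \<Rightarrow> complex"
  assumes "h \<in> borel_measurable borel" and "\<And>x. x \<in> {a..b} \<Longrightarrow> norm (h x) \<le> B"
  shows "h integrable_on {a..b}"
proof (rule measurable_bounded_by_integrable_imp_integrable)
  have "h \<in> borel_measurable lebesgue"
    using assms(1) by (intro measurable_completion) simp
  then show "h \<in> borel_measurable (lebesgue_on {a..b})"
    by (rule measurable_restrict_space1)
  show "(\<lambda>_. B) integrable_on {a..b}" by (rule integrable_const_ivl)
qed (use assms in auto)

lemma integrable_on_exp_bounded:
  fixes h :: "real \<Rightarrow> complex"
  assumes "h \<in> borel_measurable borel" and "\<And>s. norm (h s) \<le> B * exp (K * \<bar>s - x0\<bar>)"
  shows "h integrable_on {a..b}"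
proof -
  have "compact ((\<lambda>s. B * exp (K * \<bar>s - x0\<bar>)) ` {a..b})"
    by (intro compact_continuous_image continuous_intros) auto
  then obtain M where "\<And>y. y \<in> (\<lambda>s. B * exp (K * \<bar>s - x0\<bar>)) ` {a..b} \<Longrightarrow> norm y \<le> M"
    using compact_imp_bounded bounded_iff by metis
  then have "norm (h s) \<le> M" if "s \<in> {a..b}" for s
    using assms(2)[of s] that by (smt (verit) image_eqI real_norm_def)
  then show ?thesis using assms(1) integrable_on_interval_bounded by blast
qed

lemma primitive_from_continuous:
  assumes "\<And>a b. h integrable_on {a..b}"
  shows "continuous_on UNIV (primitive_from x0 h)"
proof -
  have "isCont (primitive_from x0 h) x" for x
  proof -
    have "continuous_on {x-1..x+1} (\<lambda>y. primitive_from x0 h (x-1) + integral {x-1..y} h)"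
      by (intro continuous_intros indefinite_integral_continuous_1 assms)
    then have "continuous_on {x-1..x+1} (primitive_from x0 h)"
      by (rule continuous_on_eq) (simp add: primitive_from_diff[OF assms, of "x-1" _ x0, symmetric])
    then show ?thesis
      by (rule continuous_on_interior) auto
  qed
  then show ?thesis by (simp add: continuous_on_eq_continuous_at)
qed

lemma primitive_from_has_vector_derivative:
  assumes "\<And>a b. h integrable_on {a..b}" and "isCont h x"
  shows "(primitive_from x0 h has_vector_derivative h x) (at x)"
proof -
  have "((\<lambda>y. integral {x-1..y} h) has_vector_derivative h x) (at x within ({x-1..x+1} - {}))"
    by (rule integral_has_vector_derivative_continuous_at)
       (use assms in \<open>auto simp: continuous_at_imp_continuous_within\<close>)
  moreover have "at x within {x-1..x+1} = at x"
    by (rule at_within_interior) auto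
  ultimately have "((\<lambda>y. integral {x-1..y} h) has_vector_derivative h x) (at x)" by simp
  then have *: "((\<lambda>y. primitive_from x0 h (x-1) + integral {x-1..y} h)
      has_vector_derivative h x) (at x)"
    by (auto intro!: derivative_eq_intros)
  show ?thesis
  proof (rule has_vector_derivative_transform_within_open[OF *])
    show "open {x-1<..<x+1}" "x \<in> {x-1<..<x+1}" by auto
    show "primitive_from x0 h (x - 1) + integral {x - 1..y} h = primitive_from x0 h y"
      if "y \<in> {x-1<..<x+1}" for y
      using primitive_from_diff[OF assms(1), of "x-1" y x0] that by (simp add: algebra_simps)
  qed
qed

lemma primitive_from_diff_fun:
  assumes "\<And>a b. h integrable_on {a..b}" "\<And>a b. k integrable_on {a..b}"
  shows "primitive_from x0 h x - primitive_from x0 k x = primitive_from x0 (\<lambda>s. h s - k s) x"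
  unfolding primitive_from_def using assms
  by (simp add: Henstock_Kurzweil_Integration.integral_diff)

text \<open>
  Banach's fixed point theorem for \<open>u\<close> in the norm with weight \<open>exp (- K \<bar>x - x0\<bar>)\<close>: each
  integration gains a factor \<open>1 / K\<close>, so a large \<open>K\<close> yields a contraction on the whole line at once.
\<close>

lemma volterra_exists:
  fixes e :: "real \<Rightarrow> complex" and m u0 v0 :: complex
  assumes meas [measurable]: "e \<in> borel_measurable borel" and bnd: "\<And>x. norm (e x) \<le> C"
  obtains u v where
    "continuous_on UNIV u" "continuous_on UNIV v"
    "\<And>a b. (\<lambda>s. e s * v s) integrable_on {a..b}"
    "\<And>x. u x = u0 + primitive_from x0 (\<lambda>s. e s * v s) x"
    "\<And>x. v x = v0 - m * primitive_from x0 u x"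
proof -
  \<comment> \<open>The map \<open>T\<close> below integrates twice, so its Lipschitz constant is
    \<open>C * norm m / (K * K)\<close>. This is at most \<open>1 / 2\<close>, since
    \<open>2 * C * norm m \<le> K \<le> K * K\<close>.\<close>
  define K where "K = 1 + 2 * C * norm m"
  have C: "C \<ge> 0" using bnd[of 0] norm_ge_zero order_trans by blast
  have K: "K \<ge> 1" unfolding K_def using C by simp
  define w where "w x = exp (K * \<bar>x - x0\<bar>)" for x
  have w_pos: "w x > 0" for x by (simp add: w_def)
  have w_ge: "w x \<ge> 1" for x using K by (simp add: w_def)
  have w_cont: "continuous_on UNIV w" unfolding w_def by (intro continuous_intros)
  \<comment> \<open>The iteration runs over bounded continuous \<open>g\<close>, and
    \<open>U g\<close> restores the weight. The flux is eliminated through \<open>V\<close>, so that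
    only \<open>u\<close> is iterated.\<close>
  define U where "U g x = w x * apply_bcontfun g x" for g :: "real \<Rightarrow>\<^sub>C complex" and x
  define V where "V g x = v0 - m * primitive_from x0 (U g) x" for g x
  define R where "R g x = u0 + primitive_from x0 (\<lambda>s. e s * V g s) x" for g x
  have U_cont: "continuous_on S (U g)" for g S
    unfolding U_def using w_cont by (intro continuous_intros continuous_on_of_real) (auto elim: continuous_on_subset)
  have U_int: "U g integrable_on {a..b}" for g a b
    using U_cont by (rule integrable_continuous_interval)
  have U_bnd: "norm (U g x) \<le> norm g * w x" for g x
    unfolding U_def norm_mult using w_pos[of x] norm_bounded[of g x] by simp
  have PU_bnd: "norm (primitive_from x0 (U g) x) \<le> norm g / K * w x" for g x
    unfolding w_def
    by (rule primitive_from_bound[OF U_int]) (use K U_bnd in \<open>auto simp: w_def\<close>)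
  have V_cont: "continuous_on S (V g)" for g S
    unfolding V_def
    by (intro continuous_intros continuous_on_subset[OF primitive_from_continuous[OF U_int]]) auto
  have V_meas [measurable]: "V g \<in> borel_measurable borel" for g
    using V_cont by (rule borel_measurable_continuous_onI)
  have V_bnd: "norm (V g x) \<le> (norm v0 + norm m * norm g / K) * w x" for g x
  proof -
    have "norm (V g x) \<le> norm v0 + norm m * norm (primitive_from x0 (U g) x)"
      unfolding V_def by (rule order_trans[OF norm_triangle_ineq4]) (simp add: norm_mult)
    also have "\<dots> \<le> norm v0 * w x + norm m * (norm g / K * w x)"
      using PU_bnd[of g x] w_ge[of x] mult_left_mono[OF w_ge[of x], of "norm v0"]
      by (intro add_mono mult_left_mono) auto
    finally show ?thesis by (simp add: algebra_simps)
  qed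
  have eV_bnd: "norm (e x * V g x) \<le> C * (norm v0 + norm m * norm g / K) * w x" for g x
    unfolding norm_mult mult.assoc using bnd[of x] V_bnd[of g x] C by (intro mult_mono) auto
  have eV_meas: "(\<lambda>s. e s * V g s) \<in> borel_measurable borel" for g by measurable
  have eV_int: "(\<lambda>s. e s * V g s) integrable_on {a..b}" for g a b
    by (rule integrable_on_exp_bounded[OF eV_meas eV_bnd[unfolded w_def]])
  have R_cont: "continuous_on UNIV (R g)" for g
    unfolding R_def by (intro continuous_intros primitive_from_continuous eV_int)
  have R_bnd: "norm (R g x / w x) \<le> norm u0 + C * (norm v0 + norm m * norm g / K) / K" for g x
  proof -
    have "norm (primitive_from x0 (\<lambda>s. e s * V g s) x)
        \<le> C * (norm v0 + norm m * norm g / K) / K * w x"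
      unfolding w_def
      by (rule primitive_from_bound[OF eV_int]) (use K eV_bnd in \<open>auto simp: w_def\<close>)
    then have "norm (R g x) \<le> norm u0 * w x + C * (norm v0 + norm m * norm g / K) / K * w x"
      unfolding R_def using mult_left_mono[OF w_ge[of x], of "norm u0"]
      by (intro order_trans[OF norm_triangle_ineq] add_mono) auto
    then show ?thesis using w_pos[of x] by (simp add: norm_divide field_simps)
  qed
  define T where "T g = Bcontfun (\<lambda>x. R g x / w x)" for g
  have T_apply: "apply_bcontfun (T g) x = R g x / w x" for g x
  proof -
    have "(\<lambda>x. R g x / w x) \<in> bcontfun"
    proof (rule bcontfun_normI)
      show "continuous_on UNIV (\<lambda>x. R g x / w x)"
        using R_cont w_cont w_pos by (intro continuous_intros continuous_on_of_real) (auto simp: less_imp_neq[symmetric])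
    qed (rule R_bnd)
    then show ?thesis by (simp add: T_def Bcontfun_inverse)
  qed
  have contr: "dist (T g) (T h) \<le> 1/2 * dist g h" for g h
  proof (rule dist_bound)
    fix x
    have PV: "norm (V g s - V h s) \<le> norm m * (norm (g - h) / K) * w s" for s
    proof -
      have "V g s - V h s = - m * primitive_from x0 (\<lambda>s. U g s - U h s) s"
        unfolding V_def by (simp add: primitive_from_diff_fun[OF U_int U_int, symmetric] algebra_simps)
      also have "(\<lambda>s. U g s - U h s) = U (g - h)"
        by (auto simp: U_def algebra_simps)
      finally show ?thesis
        using mult_left_mono[OF PU_bnd[of "g - h" s], of "norm m"] by (simp add: norm_mult)
    qed
    have D: "R g x - R h x = primitive_from x0 (\<lambda>s. e s * (V g s - V h s)) x"
      unfolding R_def by (simp add: primitive_from_diff_fun[OF eV_int eV_int] algebra_simps)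
    have bnd': "norm (e s * (V g s - V h s)) \<le> C * (norm m * (norm (g - h) / K)) * w s" for s
      unfolding norm_mult mult.assoc using bnd[of s] PV[of s] C by (intro mult_mono) (auto simp: mult.assoc)
    have int': "(\<lambda>s. e s * (V g s - V h s)) integrable_on {a..b}" for a b
      using integrable_diff[OF eV_int[of g a b] eV_int[of h a b]] by (simp add: algebra_simps)
    have "norm (R g x - R h x) \<le> C * (norm m * (norm (g - h) / K)) / K * w x"
      unfolding w_def D
      by (rule primitive_from_bound[OF int']) (use K bnd' in \<open>auto simp: w_def\<close>)
    moreover have "C * (norm m * (norm (g - h) / K)) / K \<le> norm (g - h) / 2"
    proof -
      have "C * norm m / (K * K) \<le> 1 / 2"
      proof -
        have "2 * C * norm m \<le> K" by (simp add: K_def)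
        also have "K \<le> K * K" using K by simp
        finally show ?thesis using K by (simp add: field_simps)
      qed
      then have "C * norm m / (K * K) * norm (g - h) \<le> 1 / 2 * norm (g - h)"
        by (rule mult_right_mono) simp
      then show ?thesis by (simp add: mult_ac)
    qed
    ultimately have "norm (R g x - R h x) \<le> norm (g - h) / 2 * w x"
      using w_pos[of x] by (smt (verit, best) mult_right_mono)
    then have "norm (R g x / w x - R h x / w x) \<le> norm (g - h) / 2"
      using w_pos[of x] by (simp add: norm_divide field_simps flip: diff_divide_distrib)
    then show "dist (apply_bcontfun (T g) x) (apply_bcontfun (T h) x) \<le> 1/2 * dist g h"
      by (simp add: T_apply dist_norm)
  qed
  have "\<exists>!g. T g = g"
    by (rule banach_fix_type[of "1/2"]) (use contr in auto)
  then obtain g where g: "T g = g" by blast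
  have "R g x / w x = apply_bcontfun g x" for x using g T_apply by metis
  then have "U g x = R g x" for x
    unfolding U_def using w_pos[of x] nonzero_mult_div_cancel_left[of "complex_of_real (w x)" "R g x"]
    by (metis less_irrefl of_real_eq_0_iff times_divide_eq_right)
  then show ?thesis
    by (intro that[of "U g" "V g"] U_cont V_cont eV_int) (auto simp: R_def V_def)
qed

subsection \<open>The first-order system of a permittivity\<close>

lemma one_sided_limits_imp_bounded_near:
  fixes e :: "real \<Rightarrow> complex"
  assumes "(e \<longlongrightarrow> l) (at_left x)" "(e \<longlongrightarrow> r) (at_right x)"
  shows "\<exists>d>0. \<exists>B. \<forall>y. \<bar>y - x\<bar> < d \<longrightarrow> norm (e y) \<le> B"
proof -
  have "\<forall>\<^sub>F y in at_left x. norm (e y) < norm l + 1"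
    using tendsto_norm[OF assms(1)] by (rule order_tendstoD) simp
  then obtain a where a: "a < x" "\<And>y. a < y \<Longrightarrow> y < x \<Longrightarrow> norm (e y) < norm l + 1"
    by (auto simp: eventually_at_left_field)
  have "\<forall>\<^sub>F y in at_right x. norm (e y) < norm r + 1"
    using tendsto_norm[OF assms(2)] by (rule order_tendstoD) simp
  then obtain b where b: "x < b" "\<And>y. x < y \<Longrightarrow> y < b \<Longrightarrow> norm (e y) < norm r + 1"
    by (auto simp: eventually_at_right_field)
  have "norm (e y) \<le> max (norm (e x)) (max (norm l + 1) (norm r + 1))"
    if "\<bar>y - x\<bar> < min (x - a) (b - x)" for y
    using a(2)[of y] b(2)[of y] that
    by (cases y x rule: linorder_cases) (auto simp: less_imp_le le_max_iff_disj)
  then show ?thesis using a(1) b(1)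
    by (intro exI[of _ "min (x - a) (b - x)"]) auto
qed

lemma periodic_int:
  fixes e :: "real \<Rightarrow> complex"
  assumes "\<And>x. e (x + 1) = e x"
  shows "e (x + of_int n) = e x"
proof (induction n rule: int_induct[where k = 0])
  case (step1 i)
  then show ?case using assms[of "x + of_int i"] by (simp add: add_ac)
next
  case (step2 i)
  then show ?case using assms[of "x + of_int (i - 1)"] by (simp add: algebra_simps)
qed simp

text \<open>The one-sided limits bound \<open>e\<close> near each point, bisection turns this into a
  bound on one period, and periodicity does the rest.\<close>

lemma permittivity_bounded:
  assumes "permittivity x0 e"
  shows "\<exists>C. \<forall>x. norm (e x) \<le> C"
proof -
  have lims: "\<exists>l. (e \<longlongrightarrow> l) (at_left x)" "\<exists>r. (e \<longlongrightarrow> r) (at_right x)" for x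
    using assms by (auto simp: permittivity_def piecewise_smooth_def)
  define P where "P a b \<longleftrightarrow> (\<exists>B. \<forall>y\<in>{a..b}. norm (e y) \<le> B)" for a b
  have "P 0 1"
  proof (rule Bolzano[of 0 1 P])
    show "P a c" if ab: "P a b" and bc: "P b c" for a b c
    proof -
      obtain B1 B2 where "\<forall>y\<in>{a..b}. norm (e y) \<le> B1" "\<forall>y\<in>{b..c}. norm (e y) \<le> B2"
        using ab bc unfolding P_def by blast
      then have "\<forall>y\<in>{a..c}. norm (e y) \<le> max B1 B2"
        by (metis atLeastAtMost_iff le_max_iff_disj linear)
      then show ?thesis by (auto simp: P_def)
    qed
    show "\<exists>d>0. \<forall>a b. a \<le> x \<and> x \<le> b \<and> b - a < d \<longrightarrow> P a b" for x
    proof -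
      obtain d B where "d > 0" "\<And>y. \<bar>y - x\<bar> < d \<Longrightarrow> norm (e y) \<le> B"
        using one_sided_limits_imp_bounded_near lims by metis
      then show ?thesis unfolding P_def
        by (intro exI[of _ d]) (auto intro!: exI[of _ B])
    qed
  qed auto
  then obtain B where B: "\<And>y. y \<in> {0..1} \<Longrightarrow> norm (e y) \<le> B" unfolding P_def by blast
  have "norm (e x) \<le> B" for x
  proof -
    have "e x = e (frac x)"
      using periodic_int[of e "frac x" "\<lfloor>x\<rfloor>"] assms by (simp add: permittivity_def frac_def)
    then show ?thesis using B[of "frac x"] frac_lt_1[of x] by (simp add: less_imp_le)
  qed
  then show ?thesis by blast
qed

lemma permittivity_finite_discont:
  assumes "permittivity x0 e"
  shows "finite ({x. \<not> isCont e x} \<inter> {a..b})"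
proof -
  obtain S where S: "\<And>a b. finite (S \<inter> {a..b})" "smooth_on (- S) e"
    using assms by (auto simp: permittivity_def piecewise_smooth_def)
  have "isCont e x" if "x \<notin> S" for x
  proof -
    have "((\<lambda>g t. vector_derivative g (at t)) ^^ 0) e differentiable (at x)"
      using S(2) that unfolding smooth_on_def by blast
    then show ?thesis by (simp add: differentiable_imp_continuous_within)
  qed
  then have "{x. \<not> isCont e x} \<inter> {a..b} \<subseteq> S \<inter> {a..b}" by auto
  then show ?thesis using S(1) finite_subset by blast
qed

lemma permittivity_eventually_isCont:
  assumes "permittivity x0 e"
  shows "\<forall>\<^sub>F y in at x. isCont e y"
proof -
  \<comment> \<open>The point \<open>x\<close> itself may be a jump; taking it out of the finite
    exceptional set leaves a neighbourhood of \<open>x\<close>.\<close>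
  have "finite ({y. \<not> isCont e y} \<inter> {x-1..x+1} - {x})"
    using permittivity_finite_discont[OF assms] by blast
  then have "open ({x-1<..<x+1} - ({y. \<not> isCont e y} \<inter> {x-1..x+1} - {x}))"
    by (intro open_Diff finite_imp_closed) auto
  then show ?thesis
    by (rule eventually_at_topological[THEN iffD2, OF exI, OF conjI]) auto
qed

lemma permittivity_borel_measurable:
  assumes "permittivity x0 e"
  shows "e \<in> borel_measurable borel"
proof (rule borel_measurable_continuous_countable_exceptions)
  have "{x. \<not> isCont e x} = (\<Union>n::nat. {x. \<not> isCont e x} \<inter> {- real n..real n})"
  proof -
    have "\<exists>n::nat. - real n \<le> x \<and> x \<le> real n" for x
      using real_arch_simple[of "\<bar>x\<bar>"] by (metis abs_le_iff minus_le_iff)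
    then show ?thesis by auto
  qed
  moreover have "countable (\<Union>n::nat. {x. \<not> isCont e x} \<inter> {- real n..real n})"
    by (intro countable_UN countable_finite permittivity_finite_discont[OF assms] countableI_type)
  ultimately show "countable {x. \<not> isCont e x}" by simp
  show "continuous_on (- {x. \<not> isCont e x}) e"
    by (auto intro!: continuous_at_imp_continuous_on)
qed

lemma permittivity_periodic: "permittivity x0 e \<Longrightarrow> e (x + 1) = e x"
  by (simp add: permittivity_def)

lemma permittivity_nonzero: "permittivity x0 e \<Longrightarrow> e x \<noteq> 0"
  by (auto simp: permittivity_def) (metis less_irrefl zero_complex.sel(1))

text \<open>A shift by an integer brings \<open>x\<close> to \<open>x0 + h\<close> with
  \<open>0 \<le> h < 1\<close>. The symmetry hypothesis covers \<open>h > 0\<close>, and at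
  \<open>h = 0\<close> both sides are the same point.\<close>

lemma permittivity_reflect:
  assumes "permittivity x0 e"
  shows "e (2 * x0 - x) = e x"
proof -
  define n where "n = \<lfloor>x - x0\<rfloor>"
  define h where "h = x - x0 - of_int n"
  have h: "0 \<le> h" "h < 1" unfolding h_def n_def by linarith+
  have per: "e (y + of_int k) = e y" for y k
    using assms by (intro periodic_int) (simp add: permittivity_def)
  have "e x = e (x0 + h)" using per[of "x0 + h" n] by (simp add: h_def)
  moreover have "e (2 * x0 - x) = e (x0 - h)"
    using per[of "x0 - h" "- n"] by (simp add: h_def)
  moreover have "e (x0 - h) = e (x0 + h)"
  proof (cases "h = 0")
    case False
    then have "e (x0 + h) = e (x0 + 1 - h)"
      using assms h by (auto simp: permittivity_def)
    also have "\<dots> = e (x0 - h)" using per[of "x0 - h" 1] by (simp add: algebra_simps)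
    finally show ?thesis by simp
  qed simp
  ultimately show ?thesis by simp
qed

lemma permittivity_isCont_shift:
  assumes "permittivity x0 e"
  shows "isCont e (x + 1) \<longleftrightarrow> isCont e x"
proof -
  have "isCont e (x + 1) \<longleftrightarrow> isCont (\<lambda>y. e (y + 1)) x"
    using isCont_o2[of x "\<lambda>y. y + 1" e] isCont_o2[of "x + 1" "\<lambda>y. y - 1" "\<lambda>y. e (y + 1)"]
    by auto
  then show ?thesis using permittivity_periodic[OF assms] by simp
qed

lemma permittivity_isCont_reflect:
  assumes "permittivity x0 e"
  shows "isCont e (2 * x0 - x) \<longleftrightarrow> isCont e x"
proof -
  have "isCont e (2 * x0 - x) \<longleftrightarrow> isCont (\<lambda>y. e (2 * x0 - y)) x"
    using isCont_o2[of x "\<lambda>y. 2 * x0 - y" e]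
      isCont_o2[of "2 * x0 - x" "\<lambda>y. 2 * x0 - y" "\<lambda>y. e (2 * x0 - y)"]
    by auto
  then show ?thesis using permittivity_reflect[OF assms] by simp
qed

section \<open>The first-order system and its symmetries\<close>

definition lin_sol ::
    "real \<Rightarrow> (real \<Rightarrow> complex) \<Rightarrow> complex \<Rightarrow> (real \<Rightarrow> complex) \<Rightarrow> (real \<Rightarrow> complex) \<Rightarrow> bool" where
  "lin_sol \<mu> e z u v \<longleftrightarrow> continuous_on UNIV u \<and> continuous_on UNIV v \<and>
     (\<forall>x. isCont e x \<longrightarrow>
        (u has_vector_derivative e x * v x) (at x) \<and>
        (v has_vector_derivative - (of_real \<mu> * z * u x)) (at x))"

lemma lin_solD:
  assumes "lin_sol \<mu> e z u v"
  shows "continuous_on S u" "continuous_on S v"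
    "isCont e x \<Longrightarrow> (u has_vector_derivative e x * v x) (at x)"
    "isCont e x \<Longrightarrow> (v has_vector_derivative - (of_real \<mu> * z * u x)) (at x)"
  using assms by (auto simp: lin_sol_def elim: continuous_on_subset)

lemma is_solution_iff_lin_sol:
  assumes "permittivity x0 e" "\<mu> > 0"
  shows "is_solution \<mu> e \<omega> u \<longleftrightarrow> (\<exists>v. lin_sol \<mu> e (\<omega>\<^sup>2) u v)"
proof -
  have "(u differentiable (at x) \<and> v x = 1 / e x * vector_derivative u (at x) \<and>
      v differentiable (at x) \<and> - (1 / of_real \<mu>) * vector_derivative v (at x) = \<omega>\<^sup>2 * u x) \<longleftrightarrow>
      ((u has_vector_derivative e x * v x) (at x) \<and>
        (v has_vector_derivative - (of_real \<mu> * \<omega>\<^sup>2 * u x)) (at x))" for v x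
  proof -
    have "e x \<noteq> 0" using assms(1) by (rule permittivity_nonzero)
    then have 1: "v x = 1 / e x * d \<longleftrightarrow> d = e x * v x" for d by (auto simp: field_simps)
    have 2: "- (1 / of_real \<mu>) * d = \<omega>\<^sup>2 * u x \<longleftrightarrow> d = - (of_real \<mu> * \<omega>\<^sup>2 * u x)" for d
      using assms(2) by (auto simp: field_simps minus_equation_iff[of d])
    show ?thesis unfolding 1 2
      by (metis differentiableI_vector vector_derivative_at vector_derivative_works)
  qed
  then show ?thesis by (auto simp: is_solution_def lin_sol_def)
qed

lemma lin_sol_lincomb:
  assumes "lin_sol \<mu> e z u1 v1" "lin_sol \<mu> e z u2 v2"
  shows "lin_sol \<mu> e z (\<lambda>x. \<alpha> * u1 x + \<beta> * u2 x) (\<lambda>x. \<alpha> * v1 x + \<beta> * v2 x)"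
  using assms unfolding lin_sol_def
  by (auto intro!: continuous_intros derivative_eq_intros simp: algebra_simps)

lemma lin_sol_shift:
  assumes "permittivity x0 e" "lin_sol \<mu> e z u v"
  shows "lin_sol \<mu> e z (\<lambda>x. u (x + 1)) (\<lambda>x. v (x + 1))"
proof -
  have shift: "((\<lambda>x. f (x + 1)) has_vector_derivative d) (at x)"
    if "(f has_vector_derivative d) (at (x + 1))" for f :: "real \<Rightarrow> complex" and d x
  proof -
    have "((\<lambda>x::real. x + 1) has_vector_derivative 1) (at x)"
      by (auto intro!: derivative_eq_intros)
    from vector_diff_chain_at[OF this that] show ?thesis by (simp add: o_def)
  qed
  have "((\<lambda>x. u (x + 1)) has_vector_derivative e x * v (x + 1)) (at x)"
       "((\<lambda>x. v (x + 1)) has_vector_derivative - (of_real \<mu> * z * u (x + 1))) (at x)"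
    if "isCont e x" for x
    using lin_solD(3,4)[OF assms(2), of "x + 1"] that permittivity_isCont_shift[OF assms(1), of x]
      permittivity_periodic[OF assms(1), of x] by (auto intro: shift)
  then show ?thesis
    using lin_solD(1,2)[OF assms(2)]
    by (auto simp: lin_sol_def intro!: continuous_on_compose2[of UNIV _ UNIV "\<lambda>x. x + 1"] continuous_intros)
qed

text \<open>Evenness of \<open>e\<close> about \<open>x0\<close> is the reason; the flux, being a
  derivative, changes sign. This symmetry exchanges decay to the right with decay to the
  left.\<close>

lemma lin_sol_reflect:
  assumes "permittivity x0 e" "lin_sol \<mu> e z u v"
  shows "lin_sol \<mu> e z (\<lambda>x. u (2 * x0 - x)) (\<lambda>x. - v (2 * x0 - x))"
proof -
  have refl: "((\<lambda>x. f (2 * x0 - x)) has_vector_derivative - d) (at x)"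
    if "(f has_vector_derivative d) (at (2 * x0 - x))" for f :: "real \<Rightarrow> complex" and d x
  proof -
    have "((\<lambda>x. 2 * x0 - x) has_vector_derivative -1) (at x)"
      by (auto intro!: derivative_eq_intros)
    from vector_diff_chain_at[OF this that] show ?thesis by (simp add: o_def)
  qed
  have "((\<lambda>x. u (2 * x0 - x)) has_vector_derivative e x * (- v (2 * x0 - x))) (at x)"
       "((\<lambda>x. - v (2 * x0 - x)) has_vector_derivative - (of_real \<mu> * z * u (2 * x0 - x))) (at x)"
    if "isCont e x" for x
    using lin_solD(3,4)[OF assms(2), of "2 * x0 - x"] that
      permittivity_isCont_reflect[OF assms(1), of x] permittivity_reflect[OF assms(1), of x]
    by (auto dest!: refl intro!: has_vector_derivative_minus)
  then show ?thesis
    using lin_solD(1,2)[OF assms(2)]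
    by (auto simp: lin_sol_def intro!: continuous_on_compose2[of UNIV _ UNIV "\<lambda>x. 2 * x0 - x"] continuous_intros)
qed

lemma lin_sol_cnj:
  assumes "\<And>x. e x \<in> \<real>" "lin_sol \<mu> e z u v"
  shows "lin_sol \<mu> e (cnj z) (\<lambda>x. cnj (u x)) (\<lambda>x. cnj (v x))"
proof -
  have cnj_e: "cnj (e x) = e x" for x using assms(1)[of x] by (simp add: Reals_cnj_iff)
  have "((\<lambda>x. cnj (u x)) has_vector_derivative e x * cnj (v x)) (at x)"
       "((\<lambda>x. cnj (v x)) has_vector_derivative - (of_real \<mu> * cnj z * cnj (u x))) (at x)"
    if "isCont e x" for x
    using lin_solD(3,4)[OF assms(2) that, THEN has_vector_derivative_cnj] by (auto simp: cnj_e)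
  then show ?thesis
    using lin_solD(1,2)[OF assms(2)] by (auto simp: lin_sol_def intro!: continuous_intros)
qed

text \<open>The Volterra equations hold on the whole line; wherever \<open>e\<close> is continuous
  they can be differentiated.\<close>

lemma lin_sol_exists:
  assumes "permittivity x0 e"
  shows "\<exists>u v. lin_sol \<mu> e z u v \<and> u x0 = u0 \<and> v x0 = v0"
proof -
  obtain C where C: "\<And>x. norm (e x) \<le> C" using permittivity_bounded[OF assms] by blast
  obtain u v where uv: "continuous_on UNIV u" "continuous_on UNIV v"
    "\<And>a b. (\<lambda>s. e s * v s) integrable_on {a..b}"
    "\<And>x. u x = u0 + primitive_from x0 (\<lambda>s. e s * v s) x"
    "\<And>x. v x = v0 - of_real \<mu> * z * primitive_from x0 u x"
    by (rule volterra_exists[OF permittivity_borel_measurable[OF assms] C,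
          where m = "of_real \<mu> * z" and ?u0.0 = u0 and ?v0.0 = v0]) (rule that)
  have ueq: "u = (\<lambda>x. u0 + primitive_from x0 (\<lambda>s. e s * v s) x)"
    and veq: "v = (\<lambda>x. v0 - of_real \<mu> * z * primitive_from x0 u x)"
    by (rule ext, rule uv(4), rule ext, rule uv(5))
  have u_int: "u integrable_on {a..b}" for a b
    using uv(1) by (auto intro: integrable_continuous_interval continuous_on_subset)
  have contu: "isCont u x" and contv: "isCont v x" for x
    using uv(1,2) by (auto simp: continuous_on_eq_continuous_at)
  have "(u has_vector_derivative e x * v x) (at x) \<and>
        (v has_vector_derivative - (of_real \<mu> * z * u x)) (at x)" if "isCont e x" for x
  proof
    have "((\<lambda>x. u0 + primitive_from x0 (\<lambda>s. e s * v s) x) has_vector_derivative 0 + e x * v x) (at x)"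
      using that contv by (intro derivative_intros primitive_from_has_vector_derivative uv(3)) auto
    then show "(u has_vector_derivative e x * v x) (at x)" by (subst ueq) simp
    have "((\<lambda>x. v0 - of_real \<mu> * z * primitive_from x0 u x) has_vector_derivative
        0 - of_real \<mu> * z * u x) (at x)"
      using contu by (intro derivative_intros primitive_from_has_vector_derivative u_int) auto
    then show "(v has_vector_derivative - (of_real \<mu> * z * u x)) (at x)" by (subst veq) simp
  qed
  then have "lin_sol \<mu> e z u v" using uv(1,2) by (simp add: lin_sol_def)
  moreover have "u x0 = u0" "v x0 = v0" using uv(4,5)[of x0] by simp_all
  ultimately show ?thesis by blast
qed

section \<open>Integral identities and uniqueness\<close>

lemma lin_sol_has_integral:
  assumes "permittivity x0 e" "lin_sol \<mu> e z u v" "a \<le> b"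
  shows "((\<lambda>x. e x * v x) has_integral u b - u a) {a..b}"
    and "((\<lambda>x. - (of_real \<mu> * z * u x)) has_integral v b - v a) {a..b}"
proof -
  note fin = permittivity_finite_discont[OF assms(1), of a b]
  show "((\<lambda>x. e x * v x) has_integral u b - u a) {a..b}"
    by (rule fundamental_theorem_of_calculus_interior_strong[OF fin assms(3)])
       (use lin_solD[OF assms(2)] in auto)
  show "((\<lambda>x. - (of_real \<mu> * z * u x)) has_integral v b - v a) {a..b}"
    by (rule fundamental_theorem_of_calculus_interior_strong[OF fin assms(3)])
       (use lin_solD[OF assms(2)] in auto)
qed

text \<open>In the derivative of \<open>u1 v2 - u2 v1\<close> the terms \<open>e v1 v2\<close>
  cancel, and the parameters enter only through \<open>z1 - z2\<close>. The jumps of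
  \<open>e\<close> do no harm: they are finitely many in \<open>[a, b]\<close>, and the Wronskian is
  continuous there.\<close>

lemma lagrange_identity:
  assumes "permittivity x0 e" "lin_sol \<mu> e z1 u1 v1" "lin_sol \<mu> e z2 u2 v2" "a \<le> b"
  shows "((\<lambda>x. of_real \<mu> * (z1 - z2) * (u1 x * u2 x)) has_integral
           (u1 b * v2 b - u2 b * v1 b) - (u1 a * v2 a - u2 a * v1 a)) {a..b}"
proof (rule fundamental_theorem_of_calculus_interior_strong
      [OF permittivity_finite_discont[OF assms(1), of a b] assms(4)])
  fix x assume "x \<in> {a<..<b} - {x. \<not> isCont e x} \<inter> {a..b}"
  then have "isCont e x" by auto
  note D = lin_solD(3,4)[OF assms(2) this] lin_solD(3,4)[OF assms(3) this]
  show "((\<lambda>x. u1 x * v2 x - u2 x * v1 x) has_vector_derivative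
      of_real \<mu> * (z1 - z2) * (u1 x * u2 x)) (at x)"
    by (rule has_vector_derivative_eq_rhs)
       (auto intro!: derivative_eq_intros D simp: algebra_simps)
qed (use lin_solD(1,2)[OF assms(2)] lin_solD(1,2)[OF assms(3)] in \<open>auto intro!: continuous_intros\<close>)

lemma wronskian_constant:
  assumes "permittivity x0 e" "lin_sol \<mu> e z u1 v1" "lin_sol \<mu> e z u2 v2"
  shows "u1 x * v2 x - u2 x * v1 x = u1 y * v2 y - u2 y * v1 y"
proof -
  have "u1 b * v2 b - u2 b * v1 b = u1 a * v2 a - u2 a * v1 a" if "a \<le> b" for a b
    using lagrange_identity[OF assms that] by (simp add: has_integral_0_eq)
  then show ?thesis by (metis linear)
qed

text \<open>Uniqueness by algebra: the Wronskian of \<open>u\<close> with each of two solutions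
  vanishes, while their mutual Wronskian is \<open>1\<close>, and Cramer's rule gives
  \<open>u = v = 0\<close>.\<close>

lemma lin_sol_zero:
  assumes e: "permittivity x0 e" and uv: "lin_sol \<mu> e z u v" and zero: "u x0 = 0" "v x0 = 0"
  shows "u x = 0 \<and> v x = 0"
proof -
  obtain p q where pq: "lin_sol \<mu> e z p q" "p x0 = 1" "q x0 = 0"
    using lin_sol_exists[OF e] by metis
  obtain r s where rs: "lin_sol \<mu> e z r s" "r x0 = 0" "s x0 = 1"
    using lin_sol_exists[OF e] by metis
  have W: "p x * s x - r x * q x = 1" "u x * q x - p x * v x = 0" "u x * s x - r x * v x = 0"
    using wronskian_constant[OF e pq(1) rs(1), of x x0] wronskian_constant[OF e uv pq(1), of x x0]
      wronskian_constant[OF e uv rs(1), of x x0] pq rs zero by simp_all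
  have "u x = u x * (p x * s x - r x * q x)" using W(1) by simp
  also have "\<dots> = p x * (u x * s x - r x * v x) - r x * (u x * q x - p x * v x)"
    by (simp add: algebra_simps)
  finally have "u x = 0" using W by simp
  moreover have "v x = v x * (p x * s x - r x * q x)" using W(1) by simp
  then have "v x = q x * (u x * s x - r x * v x) - s x * (u x * q x - p x * v x)"
    by (simp add: algebra_simps)
  then have "v x = 0" using W by simp
  ultimately show ?thesis by simp
qed

lemma lin_sol_unique:
  assumes "permittivity x0 e" "lin_sol \<mu> e z u1 v1" "lin_sol \<mu> e z u2 v2"
    and "u1 x0 = u2 x0" "v1 x0 = v2 x0"
  shows "u1 x = u2 x \<and> v1 x = v2 x"
  using lin_sol_zero[OF assms(1) lin_sol_lincomb[OF assms(2,3), of 1 "-1"], of x] assms(4,5) by simp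

text \<open>The flux is determined by the solution, since the continuity points of \<open>e\<close> are dense.\<close>

lemma lin_sol_flux_zero:
  assumes e: "permittivity x0 e" and uv: "lin_sol \<mu> e z u v" and zero: "\<And>x. u x = 0"
  shows "v x = 0"
proof -
  have "v y = 0" if "isCont e y" for y
  proof -
    have "((\<lambda>_. 0) has_vector_derivative e y * v y) (at y)"
      using lin_solD(3)[OF uv that] zero by (simp add: ext[of u "\<lambda>_. 0"])
    then have "e y * v y = 0"
      using vector_derivative_unique_at[OF _ has_vector_derivative_const] by blast
    then show ?thesis using permittivity_nonzero[OF e, of y] by simp
  qed
  moreover note permittivity_eventually_isCont[OF e, of x]
  ultimately have "\<forall>\<^sub>F y in at x. v y = 0" by (auto elim: eventually_mono)
  then have "(v \<longlongrightarrow> 0) (at x)" by (rule tendsto_eventually)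
  moreover have "(v \<longlongrightarrow> v x) (at x)"
    using lin_solD(2)[OF uv, of UNIV] by (auto simp: continuous_on_def)
  ultimately show ?thesis using tendsto_unique[of "at x"] by simp
qed

subsection \<open>Monodromy and the Floquet-Bloch spectrum\<close>

text \<open>Value and flux are chosen together, as one pair; for a permittivity
  \<open>lin_sol_unique\<close> leaves only one choice.\<close>

definition ivp :: "real \<Rightarrow> real \<Rightarrow> (real \<Rightarrow> complex) \<Rightarrow> complex \<Rightarrow> complex \<Rightarrow> complex \<Rightarrow> real \<Rightarrow> complex \<times> complex" where
  "ivp \<mu> x0 e z u0 v0 =
     (SOME w. lin_sol \<mu> e z (\<lambda>x. fst (w x)) (\<lambda>x. snd (w x)) \<and> w x0 = (u0, v0))"

definition ivp_val :: "real \<Rightarrow> real \<Rightarrow> (real \<Rightarrow> complex) \<Rightarrow> complex \<Rightarrow> complex \<Rightarrow> complex \<Rightarrow> real \<Rightarrow> complex" where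
  "ivp_val \<mu> x0 e z u0 v0 x = fst (ivp \<mu> x0 e z u0 v0 x)"

definition ivp_flux :: "real \<Rightarrow> real \<Rightarrow> (real \<Rightarrow> complex) \<Rightarrow> complex \<Rightarrow> complex \<Rightarrow> complex \<Rightarrow> real \<Rightarrow> complex" where
  "ivp_flux \<mu> x0 e z u0 v0 x = snd (ivp \<mu> x0 e z u0 v0 x)"

lemma ivp:
  assumes "permittivity x0 e"
  shows lin_sol_ivp: "lin_sol \<mu> e z (ivp_val \<mu> x0 e z u0 v0) (ivp_flux \<mu> x0 e z u0 v0)"
    and ivp_val_init: "ivp_val \<mu> x0 e z u0 v0 x0 = u0"
    and ivp_flux_init: "ivp_flux \<mu> x0 e z u0 v0 x0 = v0"
proof -
  obtain u v where "lin_sol \<mu> e z u v" "u x0 = u0" "v x0 = v0"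
    using lin_sol_exists[OF assms] by metis
  then have "lin_sol \<mu> e z (\<lambda>x. fst ((u x, v x))) (\<lambda>x. snd ((u x, v x))) \<and> (u x0, v x0) = (u0, v0)"
    by simp
  then have *: "lin_sol \<mu> e z (\<lambda>x. fst (ivp \<mu> x0 e z u0 v0 x)) (\<lambda>x. snd (ivp \<mu> x0 e z u0 v0 x)) \<and>
      ivp \<mu> x0 e z u0 v0 x0 = (u0, v0)"
    unfolding ivp_def by (rule someI[of _ "\<lambda>x. (u x, v x)"])
  then show "lin_sol \<mu> e z (ivp_val \<mu> x0 e z u0 v0) (ivp_flux \<mu> x0 e z u0 v0)"
    by (simp add: ivp_val_def[abs_def] ivp_flux_def[abs_def])
  show "ivp_val \<mu> x0 e z u0 v0 x0 = u0" "ivp_flux \<mu> x0 e z u0 v0 x0 = v0"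
    using * by (simp_all add: ivp_val_def ivp_flux_def)
qed

text \<open>
  By inversion symmetry the monodromy matrix from \<open>x0\<close> to \<open>x0 + 1\<close> has equal diagonal
  entries \<open>mono_diag\<close>; its lower left entry is \<open>mono_low\<close>.
\<close>

definition mono_diag :: "real \<Rightarrow> real \<Rightarrow> (real \<Rightarrow> complex) \<Rightarrow> complex \<Rightarrow> complex" where
  "mono_diag \<mu> x0 e z = ivp_val \<mu> x0 e z 1 0 (x0 + 1)"

definition mono_low :: "real \<Rightarrow> real \<Rightarrow> (real \<Rightarrow> complex) \<Rightarrow> complex \<Rightarrow> complex" where
  "mono_low \<mu> x0 e z = ivp_flux \<mu> x0 e z 1 0 (x0 + 1)"

text \<open>Reflection makes the first fundamental solution even and the second odd about
  \<open>x0\<close>, so their values at \<open>x0 - 1\<close> are, up to sign, again entries of the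
  monodromy matrix. Translating back to \<open>x0\<close> gives
  \<open>a^2 - b c = 1 = d^2 - b c\<close>; together with determinant \<open>1\<close> this yields
  \<open>(a - d)^2 = 0\<close>.\<close>

lemma monodromy:
  assumes e: "permittivity x0 e"
  obtains b where "(mono_diag \<mu> x0 e z)\<^sup>2 - b * mono_low \<mu> x0 e z = 1"
    and "\<And>u v. lin_sol \<mu> e z u v \<Longrightarrow> u (x0 + 1) = mono_diag \<mu> x0 e z * u x0 + b * v x0"
    and "\<And>u v. lin_sol \<mu> e z u v \<Longrightarrow> v (x0 + 1) = mono_low \<mu> x0 e z * u x0 + mono_diag \<mu> x0 e z * v x0"
proof -
  define p q r s where "p = ivp_val \<mu> x0 e z 1 0" "q = ivp_flux \<mu> x0 e z 1 0"
    "r = ivp_val \<mu> x0 e z 0 1" "s = ivp_flux \<mu> x0 e z 0 1"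
  note pqrs_def = this
  have pq: "lin_sol \<mu> e z p q" "p x0 = 1" "q x0 = 0" and rs: "lin_sol \<mu> e z r s" "r x0 = 0" "s x0 = 1"
    using ivp[OF e] by (simp_all add: pqrs_def)
  have expand: "u x = u x0 * p x + v x0 * r x \<and> v x = u x0 * q x + v x0 * s x"
    if "lin_sol \<mu> e z u v" for u v x
    by (rule lin_sol_unique[OF e that lin_sol_lincomb[OF pq(1) rs(1)]]) (simp_all add: pq rs)
  define a c b d where "a = p (x0 + 1)" "c = q (x0 + 1)" "b = r (x0 + 1)" "d = s (x0 + 1)"
  note abcd_def = this
  have "a * d - b * c = 1"
    using wronskian_constant[OF e pq(1) rs(1), of "x0 + 1" x0] by (simp add: abcd_def pq rs)
  have "p (2 * x0 - x) = p x \<and> - q (2 * x0 - x) = q x" for x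
    by (rule lin_sol_unique[OF e lin_sol_reflect[OF e pq(1)] pq(1)]) (simp_all add: pq)
  from this[of "x0 + 1"] have pm: "p (x0 - 1) = a" "q (x0 - 1) = - c"
    by (simp_all add: abcd_def minus_equation_iff[of "q _"] eq_commute)
  have "lin_sol \<mu> e z (\<lambda>x. - r x) (\<lambda>x. - s x)"
    using lin_sol_lincomb[OF rs(1) rs(1), of "-1" 0] by simp
  then have "r (2 * x0 - x) = - r x \<and> - s (2 * x0 - x) = - s x" for x
    by (rule lin_sol_unique[OF e lin_sol_reflect[OF e rs(1)]]) (simp_all add: rs)
  from this[of "x0 + 1"] have rm: "r (x0 - 1) = - b" "s (x0 - 1) = d" by (simp_all add: abcd_def)
  have "p x0 = a * p (x0 - 1) + c * r (x0 - 1)" "s x0 = b * q (x0 - 1) + d * s (x0 - 1)"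
    using expand[OF lin_sol_shift[OF e pq(1)], of "x0 - 1"] expand[OF lin_sol_shift[OF e rs(1)], of "x0 - 1"]
    by (simp_all add: abcd_def)
  then have "a * a - c * b = 1" "d * d - b * c = 1" using pm rm pq rs by simp_all
  with \<open>a * d - b * c = 1\<close> have "a * a - 2 * (a * d) + d * d = 0" "a\<^sup>2 - b * c = 1"
    by (simp_all add: algebra_simps power2_eq_square)
  then have "(a - d)\<^sup>2 = 0" by (simp add: power2_eq_square algebra_simps)
  then have "d = a" by simp
  show ?thesis
  proof (rule that[of b])
    show "(mono_diag \<mu> x0 e z)\<^sup>2 - b * mono_low \<mu> x0 e z = 1"
      using \<open>a\<^sup>2 - b * c = 1\<close> by (simp add: mono_diag_def mono_low_def abcd_def pqrs_def)
  next
    fix u v assume "lin_sol \<mu> e z u v"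
    from expand[OF this, of "x0 + 1"]
    show "u (x0 + 1) = mono_diag \<mu> x0 e z * u x0 + b * v x0"
      "v (x0 + 1) = mono_low \<mu> x0 e z * u x0 + mono_diag \<mu> x0 e z * v x0"
      using \<open>d = a\<close> by (simp_all add: mono_diag_def mono_low_def abcd_def pqrs_def)
  qed
qed

text \<open>The two roots have product \<open>1\<close>, so one of them always lies in the closed unit disc.\<close>

definition multiplier :: "real \<Rightarrow> real \<Rightarrow> (real \<Rightarrow> complex) \<Rightarrow> complex \<Rightarrow> complex" where
  "multiplier \<mu> x0 e z = (SOME \<rho>. norm \<rho> \<le> 1 \<and> \<rho>\<^sup>2 - 2 * mono_diag \<mu> x0 e z * \<rho> + 1 = 0)"

lemma multiplier:
  shows norm_multiplier_le: "norm (multiplier \<mu> x0 e z) \<le> 1"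
    and multiplier_root: "(multiplier \<mu> x0 e z)\<^sup>2 - 2 * mono_diag \<mu> x0 e z * multiplier \<mu> x0 e z + 1 = 0"
proof -
  define a where "a = mono_diag \<mu> x0 e z"
  define s where "s = csqrt (a\<^sup>2 - 1)"
  have s: "s * s = a * a - 1" 
    using power2_csqrt[of "a\<^sup>2 - 1"] unfolding s_def by (simp only: power2_eq_square)
  have prod: "(a + s) * (a - s) = 1" using s by (simp add: algebra_simps)
  have root: "(a + s)\<^sup>2 - 2 * a * (a + s) + 1 = 0" "(a - s)\<^sup>2 - 2 * a * (a - s) + 1 = 0"
    using s by (simp_all add: power2_eq_square algebra_simps)
  have "norm (a + s) * norm (a - s) = 1" using prod by (metis norm_mult norm_one)
  then have "norm (a + s) \<le> 1 \<or> norm (a - s) \<le> 1"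
    by (metis less_le_not_le linorder_not_le mult_strict_mono' norm_ge_zero mult_1 zero_le_one)
  with root have "\<exists>\<rho>. norm \<rho> \<le> 1 \<and> \<rho>\<^sup>2 - 2 * mono_diag \<mu> x0 e z * \<rho> + 1 = 0"
    unfolding a_def by blast
  from someI_ex[OF this] show "norm (multiplier \<mu> x0 e z) \<le> 1"
    "(multiplier \<mu> x0 e z)\<^sup>2 - 2 * mono_diag \<mu> x0 e z * multiplier \<mu> x0 e z + 1 = 0"
    by (simp_all add: multiplier_def)
qed

text \<open>The quadratic is palindromic, so its roots are reciprocal: eliminating \<open>a\<close>
  between the equations for \<open>m\<close> and \<open>\<rho>\<close> leaves
  \<open>(m - \<rho>) * (\<rho> * m - 1) = 0\<close>.\<close>

lemma multiplier_characterization: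
  assumes "\<rho>\<^sup>2 - 2 * mono_diag \<mu> x0 e z * \<rho> + 1 = 0"
  shows "\<rho> = multiplier \<mu> x0 e z \<or> \<rho> * multiplier \<mu> x0 e z = 1"
proof -
  define a where "a = mono_diag \<mu> x0 e z"
  define m where "m = multiplier \<mu> x0 e z"
  have "\<rho>\<^sup>2 - 2 * a * \<rho> + 1 = 0" "m\<^sup>2 - 2 * a * m + 1 = 0"
    using assms multiplier_root[of \<mu> x0 e z] by (simp_all add: a_def m_def)
  moreover have "(m - \<rho>) * (\<rho> * m - 1) = \<rho> * (m\<^sup>2 - 2 * a * m + 1) - m * (\<rho>\<^sup>2 - 2 * a * \<rho> + 1)"
    by (simp add: power2_eq_square algebra_simps)
  ultimately have "(m - \<rho>) * (\<rho> * m - 1) = 0" by simp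
  then show ?thesis by (auto simp: m_def)
qed

text \<open>The denominator can only vanish outside the band gap, see \<open>mono_low_nonzero\<close>.\<close>

definition zeta :: "real \<Rightarrow> real \<Rightarrow> (real \<Rightarrow> complex) \<Rightarrow> complex \<Rightarrow> complex" where
  "zeta \<mu> x0 e z = (multiplier \<mu> x0 e z - mono_diag \<mu> x0 e z) / mono_low \<mu> x0 e z"

text \<open>If \<open>a^2 = 1\<close>, the quadratic has the double root \<open>a\<close>, of
  modulus \<open>1\<close>. In the gap \<open>b * c = a^2 - 1\<close> is thus nonzero, which makes
  \<open>zeta\<close> finite and nonzero.\<close>

lemma mono_low_nonzero:
  assumes e: "permittivity x0 e" and "norm (multiplier \<mu> x0 e z) < 1"
  shows "mono_low \<mu> x0 e z \<noteq> 0" "multiplier \<mu> x0 e z \<noteq> mono_diag \<mu> x0 e z"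
proof -
  define a where "a = mono_diag \<mu> x0 e z"
  define m where "m = multiplier \<mu> x0 e z"
  have eq: "m\<^sup>2 - 2 * a * m + 1 = 0"
    using multiplier_root[of \<mu> x0 e z] by (simp add: a_def m_def)
  have sq: "a\<^sup>2 \<noteq> 1"
  proof
    assume a: "a\<^sup>2 = 1"
    then have "(m - a)\<^sup>2 = 0" using eq by (simp add: power2_eq_square algebra_simps)
    then have "m = a" by simp
    moreover have "norm a = 1" using a by (auto simp: power2_eq_1_iff)
    ultimately show False using assms(2) by (simp add: m_def)
  qed
  show "m \<noteq> mono_diag \<mu> x0 e z"
    using eq sq by (auto simp: a_def[symmetric] power2_eq_square)
  obtain b where "a\<^sup>2 - b * mono_low \<mu> x0 e z = 1" using monodromy[OF e] unfolding a_def by metis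
  then show "mono_low \<mu> x0 e z \<noteq> 0" using sq by auto
qed

lemma bloch_extend:
  assumes e: "permittivity x0 e" and uv: "lin_sol \<mu> e z u v"
    and "u (x0 + 1) = \<rho> * u x0" "v (x0 + 1) = \<rho> * v x0"
  shows "u (x + 1) = \<rho> * u x \<and> v (x + 1) = \<rho> * v x"
  using lin_sol_unique[OF e lin_sol_shift[OF e uv] lin_sol_lincomb[OF uv uv, of \<rho> 0], of x] assms(3,4)
  by simp

text \<open>The factor of a nonzero quasi-periodic solution is an eigenvalue of the monodromy
  matrix, hence \<open>m\<close> or its reciprocal, and both have modulus \<open>1\<close> as soon
  as one has.\<close>

lemma spectrum_iff:
  assumes e: "permittivity x0 e" and "\<mu> > 0"
  shows "\<omega> \<in> floquet_bloch_spectrum \<mu> e \<longleftrightarrow> norm (multiplier \<mu> x0 e (\<omega>\<^sup>2)) = 1"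
proof -
  define m where "m = multiplier \<mu> x0 e (\<omega>\<^sup>2)"
  define a where "a = mono_diag \<mu> x0 e (\<omega>\<^sup>2)"
  define c where "c = mono_low \<mu> x0 e (\<omega>\<^sup>2)"
  obtain b where b: "a\<^sup>2 - b * c = 1"
    "\<And>u v. lin_sol \<mu> e (\<omega>\<^sup>2) u v \<Longrightarrow> u (x0 + 1) = a * u x0 + b * v x0"
    "\<And>u v. lin_sol \<mu> e (\<omega>\<^sup>2) u v \<Longrightarrow> v (x0 + 1) = c * u x0 + a * v x0"
    by (rule monodromy[OF e, of \<mu> "\<omega>\<^sup>2", folded a_def c_def]) (rule that)
  have m: "m\<^sup>2 - 2 * a * m + 1 = 0" unfolding m_def a_def by (rule multiplier_root)
  show ?thesis
    unfolding m_def[symmetric]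
  proof
    assume "\<omega> \<in> floquet_bloch_spectrum \<mu> e"
    then obtain \<kappa> u where u: "nonzero_solution \<mu> e \<omega> u"
      "\<And>x. u (x + 1) = exp (\<i> * complex_of_real \<kappa>) * u x"
      by (auto simp: floquet_bloch_spectrum_def)
    define \<rho> where "\<rho> = exp (\<i> * complex_of_real \<kappa>)"
    obtain v where uv: "lin_sol \<mu> e (\<omega>\<^sup>2) u v"
      using u(1) is_solution_iff_lin_sol[OF assms] by (auto simp: nonzero_solution_def)
    \<comment> \<open>The function \<open>u (x + 1) - \<rho> * u x\<close> is a solution that
      vanishes identically, so its flux vanishes too; this is the quasi-periodicity of
      \<open>v\<close>.\<close>
    have "v (x0 + 1) - \<rho> * v x0 = 0"
      using lin_sol_flux_zero[OF e lin_sol_lincomb[OF lin_sol_shift[OF e uv] uv, of 1 "- \<rho>"], of x0] u(2)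
      by (simp add: \<rho>_def)
    then have 1: "c * u x0 = (\<rho> - a) * v x0" using b(3)[OF uv] by (simp add: algebra_simps)
    have 2: "b * v x0 = (\<rho> - a) * u x0" using b(2)[OF uv] u(2)[of x0] by (simp add: algebra_simps \<rho>_def)
    have nz: "u x0 \<noteq> 0 \<or> v x0 \<noteq> 0"
      using lin_sol_zero[OF e uv] u(1) by (auto simp: nonzero_solution_def)
    have "(b * c) * u x0 = (\<rho> - a)\<^sup>2 * u x0" "(b * c) * v x0 = (\<rho> - a)\<^sup>2 * v x0"
      using 1 2 by (metis mult.assoc mult.commute power2_eq_square)+
    with nz have "b * c = (\<rho> - a)\<^sup>2" by auto
    then have "\<rho>\<^sup>2 - 2 * a * \<rho> + 1 = 0" using b(1) by (simp add: power2_eq_square algebra_simps)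
    then have "\<rho> = m \<or> \<rho> * m = 1" unfolding a_def m_def by (rule multiplier_characterization)
    moreover have "norm \<rho> = 1" by (simp add: \<rho>_def)
    ultimately show "norm m = 1" by (metis mult_1 norm_mult norm_one)
  next
    assume "norm m = 1"
    \<comment> \<open>An eigenvector for \<open>m\<close>: the second row suggests
      \<open>(m - a, c)\<close>, which degenerates only if \<open>c = 0\<close>; then
      \<open>m = a\<close>, and \<open>(1, 0)\<close> works.\<close>
    have "\<exists>u0 v0. (u0 \<noteq> 0 \<or> v0 \<noteq> 0) \<and> a * u0 + b * v0 = m * u0 \<and> c * u0 + a * v0 = m * v0"
    proof (cases "c = 0")
      case True
      then have "(m - a)\<^sup>2 = 0" using b(1) m by (simp add: power2_eq_square algebra_simps)
      then have "m = a" by simp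
      then show ?thesis using True by (intro exI[of _ 1] exI[of _ 0]) simp
    next
      case False
      have "b * c = (m - a) * (m - a)" using b(1) m by (simp add: power2_eq_square algebra_simps)
      then have "a * (m - a) + b * c = m * (m - a)" by (simp add: algebra_simps)
      then show ?thesis using False
        by (intro exI[of _ "m - a"] exI[of _ c]) (simp add: algebra_simps)
    qed
    then obtain u0 v0 where uv0: "u0 \<noteq> 0 \<or> v0 \<noteq> 0" "a * u0 + b * v0 = m * u0" "c * u0 + a * v0 = m * v0"
      by blast
    obtain u v where uv: "lin_sol \<mu> e (\<omega>\<^sup>2) u v" "u x0 = u0" "v x0 = v0"
      using lin_sol_exists[OF e] by metis
    have ext: "u (x + 1) = m * u x \<and> v (x + 1) = m * v x" for x
      using b(2,3)[OF uv(1)] uv uv0 by (intro bloch_extend[OF e uv(1)]) simp_all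
    \<comment> \<open>The initial value \<open>u0\<close> may be zero, but then
      \<open>v0 \<noteq> 0\<close>, which an identically vanishing \<open>u\<close> would
      exclude.\<close>
    have "\<exists>x. u x \<noteq> 0"
      using lin_sol_flux_zero[OF e uv(1)] uv uv0 by metis
    then have sol: "nonzero_solution \<mu> e \<omega> u"
      using uv(1) is_solution_iff_lin_sol[OF assms] by (auto simp: nonzero_solution_def)
    have "m = exp (\<i> * complex_of_real (Arg m))"
      using Arg_eq[of m] \<open>norm m = 1\<close> by (cases "m = 0") auto
    moreover have "vector_derivative u (at (x + 1)) = m * vector_derivative u (at x)" if "isCont e x" for x
    proof -
      have "isCont e (x + 1)" using that permittivity_isCont_shift[OF e] by blast
      then show ?thesis
        using lin_solD(3)[OF uv(1), THEN vector_derivative_at] that ext[of x] permittivity_periodic[OF e, of x]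
        by simp
    qed
    ultimately show "\<omega> \<in> floquet_bloch_spectrum \<mu> e"
      unfolding floquet_bloch_spectrum_def using ext sol Arg_le_pi[of m] mpi_less_Arg[of m]
      by (auto intro!: bexI[of _ "Arg m"] exI[of _ u] simp: less_imp_le)
  qed
qed

lemma gap_iff:
  assumes "permittivity x0 eA" "permittivity x0 eB" "\<mu> > 0"
  shows "\<omega> \<in> common_band_gap \<mu> eA eB \<longleftrightarrow>
    norm (multiplier \<mu> x0 eA (\<omega>\<^sup>2)) < 1 \<and> norm (multiplier \<mu> x0 eB (\<omega>\<^sup>2)) < 1"
  using assms norm_multiplier_le[of \<mu> x0 eA "\<omega>\<^sup>2"] norm_multiplier_le[of \<mu> x0 eB "\<omega>\<^sup>2"]
  by (auto simp: common_band_gap_def spectrum_iff less_le)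

section \<open>Bloch solutions with unit flux at the interface\<close>

definition bloch_val :: "real \<Rightarrow> real \<Rightarrow> (real \<Rightarrow> complex) \<Rightarrow> complex \<Rightarrow> real \<Rightarrow> complex" where
  "bloch_val \<mu> x0 e z = ivp_val \<mu> x0 e z (zeta \<mu> x0 e z) 1"

definition bloch_flux :: "real \<Rightarrow> real \<Rightarrow> (real \<Rightarrow> complex) \<Rightarrow> complex \<Rightarrow> real \<Rightarrow> complex" where
  "bloch_flux \<mu> x0 e z = ivp_flux \<mu> x0 e z (zeta \<mu> x0 e z) 1"

lemma bloch:
  assumes e: "permittivity x0 e"
  shows lin_sol_bloch: "lin_sol \<mu> e z (bloch_val \<mu> x0 e z) (bloch_flux \<mu> x0 e z)"
    and bloch_val_init: "bloch_val \<mu> x0 e z x0 = zeta \<mu> x0 e z"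
    and bloch_flux_init: "bloch_flux \<mu> x0 e z x0 = 1"
  using ivp[OF e] by (simp_all add: bloch_val_def bloch_flux_def)

text \<open>The vector \<open>(zeta, 1)\<close> is an eigenvector of the monodromy matrix: the
  second row is the definition of \<open>zeta\<close>, and the first follows from the quadratic for
  \<open>m\<close> after multiplication by \<open>c \<noteq> 0\<close>.\<close>

lemma bloch_shift:
  assumes e: "permittivity x0 e" and gap: "norm (multiplier \<mu> x0 e z) < 1"
  shows "bloch_val \<mu> x0 e z (x + 1) = multiplier \<mu> x0 e z * bloch_val \<mu> x0 e z x"
    and "bloch_flux \<mu> x0 e z (x + 1) = multiplier \<mu> x0 e z * bloch_flux \<mu> x0 e z x"
proof -
  define m where "m = multiplier \<mu> x0 e z"
  define a where "a = mono_diag \<mu> x0 e z"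
  define c where "c = mono_low \<mu> x0 e z"
  define t where "t = zeta \<mu> x0 e z"
  obtain b where b: "a\<^sup>2 - b * c = 1"
    "\<And>u v. lin_sol \<mu> e z u v \<Longrightarrow> u (x0 + 1) = a * u x0 + b * v x0"
    "\<And>u v. lin_sol \<mu> e z u v \<Longrightarrow> v (x0 + 1) = c * u x0 + a * v x0"
    by (rule monodromy[OF e, of \<mu> z, folded a_def c_def]) (rule that)
  have m: "m\<^sup>2 - 2 * a * m + 1 = 0" unfolding m_def a_def by (rule multiplier_root)
  have c: "c \<noteq> 0" unfolding c_def by (rule mono_low_nonzero[OF e gap])
  have t: "c * t = m - a" using c by (simp add: t_def zeta_def m_def a_def c_def)
  have "c * (a * t + b) = a * (c * t) + b * c" by (simp add: algebra_simps)
  also have "\<dots> = a * (m - a) + b * c" by (simp only: t)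
  also have "\<dots> = m * (m - a)" using b(1) m by (simp add: power2_eq_square algebra_simps)
  also have "\<dots> = m * (c * t)" by (simp only: t)
  finally have "a * t + b = m * t" using c by (metis mult.left_commute mult_cancel_left)
  moreover have "c * t + a = m" using t by simp
  ultimately have "bloch_val \<mu> x0 e z (x + 1) = m * bloch_val \<mu> x0 e z x \<and>
      bloch_flux \<mu> x0 e z (x + 1) = m * bloch_flux \<mu> x0 e z x"
    using b(2,3)[OF lin_sol_bloch[OF e]] bloch[OF e, of \<mu> z]
    by (intro bloch_extend[OF e lin_sol_bloch[OF e]]) (simp_all add: t_def)
  then show "bloch_val \<mu> x0 e z (x + 1) = multiplier \<mu> x0 e z * bloch_val \<mu> x0 e z x"
    "bloch_flux \<mu> x0 e z (x + 1) = multiplier \<mu> x0 e z * bloch_flux \<mu> x0 e z x"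
    by (simp_all add: m_def)
qed

subsection \<open>Decaying solutions and surface impedances\<close>

lemma shift_power:
  fixes f :: "real \<Rightarrow> complex"
  assumes "\<And>x. f (x + 1) = \<rho> * f x"
  shows "f (x + real n) = \<rho> ^ n * f x"
proof (induction n)
  case (Suc n)
  then show ?case using assms[of "x + real n"] by (simp add: add_ac)
qed simp

lemma contracting_shift_tendsto_0:
  fixes f :: "real \<Rightarrow> complex"
  assumes cont: "continuous_on UNIV f" and shift: "\<And>x. f (x + 1) = \<rho> * f x" and "norm \<rho> < 1"
  shows "(f \<longlongrightarrow> 0) at_top"
proof -
  have "compact (f ` {0..1})"
    using cont by (intro compact_continuous_image) (auto elim: continuous_on_subset)
  then obtain M where M: "\<And>x. x \<in> {0..1} \<Longrightarrow> norm (f x) \<le> M"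
    using compact_imp_bounded bounded_iff by (metis imageI)
  have bnd: "norm (f x) \<le> norm \<rho> ^ nat \<lfloor>x\<rfloor> * M" if "x \<ge> 0" for x
  proof -
    have "f x = f (frac x + real (nat \<lfloor>x\<rfloor>))"
      using that by (simp add: frac_def)
    also have "\<dots> = \<rho> ^ nat \<lfloor>x\<rfloor> * f (frac x)" by (rule shift_power[of f \<rho>, OF shift])
    finally show ?thesis
      using M[of "frac x"] frac_lt_1[of x] by (simp add: norm_mult norm_power mult_left_mono less_imp_le)
  qed
  have "((\<lambda>n. norm \<rho> ^ n * M) \<longlongrightarrow> 0 * M) sequentially"
    using assms(3) by (intro tendsto_intros LIMSEQ_power_zero) auto
  then have "((\<lambda>n. norm \<rho> ^ n * M) \<longlongrightarrow> 0) sequentially" by simp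
  then have "((\<lambda>x. norm \<rho> ^ nat \<lfloor>x\<rfloor> * M) \<longlongrightarrow> 0) at_top"
    by (rule filterlim_compose)
       (rule filterlim_compose[OF filterlim_nat_sequentially filterlim_floor_sequentially])
  then show ?thesis
    by (rule Lim_null_comparison[OF eventually_mono[OF eventually_ge_at_top[of 0]], rotated]) (rule bnd)
qed

lemma filterlim_reflect_at_bot: "filterlim (\<lambda>x::real. 2 * c - x) at_top at_bot"
  using filterlim_tendsto_add_at_top[OF tendsto_const filterlim_uminus_at_top_at_bot, of "2 * c"] by simp

lemma filterlim_reflect_at_top: "filterlim (\<lambda>x::real. 2 * c - x) at_bot at_top"
  unfolding filterlim_at_bot
proof
  show "\<forall>\<^sub>F x in at_top. 2 * c - x \<le> Z" for Z
    using eventually_ge_at_top[of "2 * c - Z"] by eventually_elim simp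
qed

text \<open>Since \<open>u' = e v\<close> with bounded \<open>e\<close>, decay of the flux forces
  decay of the derivative.\<close>

lemma decays_if_flux_tendsto_0:
  assumes e: "permittivity x0 e" and uv: "lin_sol \<mu> e z u v"
    and "(u \<longlongrightarrow> 0) F" "(v \<longlongrightarrow> 0) F"
  shows "decays F e u"
proof -
  obtain C where C: "\<And>x. norm (e x) \<le> C" using permittivity_bounded[OF e] by blast
  let ?G = "inf F (principal {x. isCont e x})"
  have "(v \<longlongrightarrow> 0) ?G" using assms(4) by (rule tendsto_mono[rotated]) simp
  then have "((\<lambda>x. C * norm (v x)) \<longlongrightarrow> C * norm (0::complex)) ?G"
    by (intro tendsto_intros)
  then have lim: "((\<lambda>x. C * norm (v x)) \<longlongrightarrow> 0) ?G" by simp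
  have "norm (vector_derivative u (at x)) \<le> C * norm (v x)" if "isCont e x" for x
    using vector_derivative_at[OF lin_solD(3)[OF uv that]] C[of x]
    by (simp add: norm_mult mult_right_mono)
  then have "\<forall>\<^sub>F x in ?G. norm (vector_derivative u (at x)) \<le> C * norm (v x)"
    by (auto simp: eventually_inf_principal)
  then have "((\<lambda>x. vector_derivative u (at x)) \<longlongrightarrow> 0) ?G"
    using lim by (rule Lim_null_comparison)
  with assms(3) show ?thesis by (simp add: decays_def)
qed

lemma bloch_tendsto_0:
  assumes e: "permittivity x0 e" and gap: "norm (multiplier \<mu> x0 e z) < 1"
  shows "(bloch_val \<mu> x0 e z \<longlongrightarrow> 0) at_top" "(bloch_flux \<mu> x0 e z \<longlongrightarrow> 0) at_top"
  using lin_solD(1,2)[OF lin_sol_bloch[OF e]] bloch_shift[OF e gap] gap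
  by (auto intro!: contracting_shift_tendsto_0)

lemma bloch_nonzero:
  assumes e: "permittivity x0 e"
  shows "\<exists>x. bloch_val \<mu> x0 e z x \<noteq> 0"
  using lin_sol_flux_zero[OF e lin_sol_bloch[OF e, of \<mu> z], of x0] bloch_flux_init[OF e, of \<mu> z] by auto

lemma zeta_nonzero:
  assumes e: "permittivity x0 e" and gap: "norm (multiplier \<mu> x0 e z) < 1"
  shows "zeta \<mu> x0 e z \<noteq> 0"
  using mono_low_nonzero[OF assms] by (simp add: zeta_def)

text \<open>Uniqueness up to scaling. As \<open>zeta \<noteq> 0\<close>, the Bloch solution and its
  reflection have independent data \<open>(zeta, 1)\<close> and \<open>(zeta, -1)\<close> at
  \<open>x0\<close> and span all solutions; the reflected one grows to the right, so its coefficient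
  must vanish.\<close>

lemma tendsto_0_imp_bloch:
  assumes e: "permittivity x0 e" and gap: "norm (multiplier \<mu> x0 e z) < 1"
    and uv: "lin_sol \<mu> e z u v" and lim: "(u \<longlongrightarrow> 0) at_top"
  obtains k where "\<And>x. u x = k * bloch_val \<mu> x0 e z x" "\<And>x. v x = k * bloch_flux \<mu> x0 e z x"
proof -
  define \<rho> where "\<rho> = multiplier \<mu> x0 e z"
  define p where "p = bloch_val \<mu> x0 e z"
  define q where "q = bloch_flux \<mu> x0 e z"
  define t where "t = zeta \<mu> x0 e z"
  have t: "t \<noteq> 0" unfolding t_def by (rule zeta_nonzero[OF e gap])
  have pq: "lin_sol \<mu> e z p q" "p x0 = t" "q x0 = 1"
    using bloch[OF e] by (simp_all add: p_def q_def t_def)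
  \<comment> \<open>These solve \<open>t * (k + l) = u x0\<close> and
    \<open>k - l = v x0\<close>.\<close>
  define k where "k = (u x0 / t + v x0) / 2"
  define l where "l = (u x0 / t - v x0) / 2"
  have expand: "u x = k * p x + l * p (2 * x0 - x) \<and> v x = k * q x + l * - q (2 * x0 - x)" for x
    using t pq(2,3)
    by (intro lin_sol_unique[OF e uv lin_sol_lincomb[OF pq(1) lin_sol_reflect[OF e pq(1)]]])
       (simp_all add: k_def l_def field_simps)
  obtain y where y: "p y \<noteq> 0" using bloch_nonzero[OF e] unfolding p_def by metis
  define x where "x = 2 * x0 - y"
  have shift: "p (x + 1) = \<rho> * p x" for x unfolding p_def \<rho>_def by (rule bloch_shift[OF e gap])
  \<comment> \<open>At \<open>x + real n\<close> the reflected part is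
    \<open>l * p (y - real n)\<close>. Multiplication by \<open>\<rho> ^ n\<close> makes it constant
    in \<open>n\<close>, whereas the other terms tend to \<open>0\<close>.\<close>
  have "l * p y = \<rho> ^ n * (u (x + real n) - k * p (x + real n))" for n
    using expand[of "x + real n"] shift_power[of p \<rho>, OF shift, of "y - real n" n]
    by (simp add: x_def algebra_simps)
  moreover have "(\<lambda>n. \<rho> ^ n * (u (x + real n) - k * p (x + real n))) \<longlonglongrightarrow> 0 * (0 - k * 0)"
  proof (intro tendsto_intros LIMSEQ_power_zero)
    have F: "filterlim (\<lambda>n. x + real n) at_top sequentially"
      by (intro filterlim_tendsto_add_at_top[OF tendsto_const] filterlim_real_sequentially)
    show "(\<lambda>n. u (x + real n)) \<longlonglongrightarrow> 0" by (rule filterlim_compose[OF lim F])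
    show "(\<lambda>n. p (x + real n)) \<longlonglongrightarrow> 0"
      unfolding p_def by (rule filterlim_compose[OF bloch_tendsto_0(1)[OF e gap] F])
  qed (use gap in \<open>simp add: \<rho>_def\<close>)
  ultimately have "(\<lambda>n::nat. l * p y) \<longlonglongrightarrow> 0" by simp
  then have "l = 0" using y by (simp add: tendsto_const_iff)
  with expand show ?thesis by (intro that[of k]) (simp_all add: p_def q_def)
qed

text \<open>Near \<open>x\<close>, apart from \<open>x\<close> itself, \<open>u' = e v\<close> with
  \<open>v\<close> continuous, so the one-sided limit of \<open>u'\<close> is that of
  \<open>e\<close> times \<open>v x\<close>; the limit of \<open>e\<close> has positive real part
  and can be cancelled.\<close>

lemma one_sided_flux_eq:
  assumes e: "permittivity x0 e" and uv: "lin_sol \<mu> e z u v" and G: "G = at_left x \<or> G = at_right x"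
  shows "one_sided_flux G e u = v x" and "Lim G u = u x"
proof -
  have G': "G \<le> at x" "G \<noteq> bot"
    using G by (elim disjE; simp add: at_le)+
  have "\<exists>l. (e \<longlongrightarrow> l) G" using e G by (auto simp: permittivity_def piecewise_smooth_def)
  then obtain l where l: "(e \<longlongrightarrow> l) G" by blast
  have Lim_e: "Lim G e = l" using G'(2) l by (simp add: tendsto_Lim)
  have "Re l > 0" using e G unfolding Lim_e[symmetric] permittivity_def by auto
  then have "l \<noteq> 0" by auto
  have "(u \<longlongrightarrow> u x) (at x)" "(v \<longlongrightarrow> v x) (at x)"
    using lin_solD(1,2)[OF uv, of UNIV] by (auto simp: continuous_on_def)
  then have lim: "(u \<longlongrightarrow> u x) G" "(v \<longlongrightarrow> v x) G" using G'(1) tendsto_mono by blast+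
  then show "Lim G u = u x" using G'(2) by (simp add: tendsto_Lim)
  have "\<forall>\<^sub>F y in G. isCont e y"
    using permittivity_eventually_isCont[OF e] G'(1) filter_leD by blast
  then have "\<forall>\<^sub>F y in G. e y * v y = vector_derivative u (at y)"
    by (rule eventually_mono) (simp add: vector_derivative_at[OF lin_solD(3)[OF uv]])
  then have "((\<lambda>y. vector_derivative u (at y)) \<longlongrightarrow> l * v x) G"
    using tendsto_mult[OF l lim(2)] by (rule tendsto_cong[THEN iffD1])
  then show "one_sided_flux G e u = v x"
    using \<open>l \<noteq> 0\<close> G'(2) Lim_e by (simp add: one_sided_flux_def tendsto_Lim)
qed

text \<open>The Bloch solution is a witness for the choice in \<open>decaying_solution\<close>;
  \<open>tendsto_0_imp_bloch\<close> then identifies whatever was chosen, up to the factor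
  \<open>k\<close>.\<close>

lemma decaying_solution_at_top:
  assumes e: "permittivity x0 e" and "\<mu> > 0" and gap: "norm (multiplier \<mu> x0 e (\<omega>\<^sup>2)) < 1"
  obtains k v where "k \<noteq> 0" "lin_sol \<mu> e (\<omega>\<^sup>2) (decaying_solution at_top \<mu> e \<omega>) v"
    "decaying_solution at_top \<mu> e \<omega> x0 = k * zeta \<mu> x0 e (\<omega>\<^sup>2)" "v x0 = k"
proof -
  let ?u = "decaying_solution at_top \<mu> e \<omega>"
  have "nonzero_solution \<mu> e \<omega> (bloch_val \<mu> x0 e (\<omega>\<^sup>2)) \<and> decays at_top e (bloch_val \<mu> x0 e (\<omega>\<^sup>2))"
    using bloch_nonzero[OF e] is_solution_iff_lin_sol[OF e \<open>\<mu> > 0\<close>] lin_sol_bloch[OF e]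
      decays_if_flux_tendsto_0[OF e lin_sol_bloch[OF e] bloch_tendsto_0[OF e gap]]
    unfolding nonzero_solution_def by blast
  then have u: "nonzero_solution \<mu> e \<omega> ?u \<and> decays at_top e ?u"
    unfolding decaying_solution_def by (rule someI[of "\<lambda>u. nonzero_solution \<mu> e \<omega> u \<and> decays _ e u"])
  then obtain v where uv: "lin_sol \<mu> e (\<omega>\<^sup>2) ?u v"
    using is_solution_iff_lin_sol[OF e \<open>\<mu> > 0\<close>] by (auto simp: nonzero_solution_def)
  have "(?u \<longlongrightarrow> 0) at_top" using u by (simp add: decays_def)
  from tendsto_0_imp_bloch[OF e gap uv this] obtain k where
    k: "\<And>x. ?u x = k * bloch_val \<mu> x0 e (\<omega>\<^sup>2) x" "\<And>x. v x = k * bloch_flux \<mu> x0 e (\<omega>\<^sup>2) x"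
    by metis
  have "k \<noteq> 0" using u k(1) by (auto simp: nonzero_solution_def)
  then show ?thesis
    using k[of x0] bloch[OF e] uv by (intro that[of k v]) simp_all
qed

text \<open>Reflection reduces this to decay along \<open>at_top\<close>. The flux at
  \<open>x0\<close> becomes \<open>- k\<close>, a sign that the minus in \<open>impedance_A\<close>
  compensates.\<close>

lemma decaying_solution_at_bot:
  assumes e: "permittivity x0 e" and "\<mu> > 0" and gap: "norm (multiplier \<mu> x0 e (\<omega>\<^sup>2)) < 1"
  obtains k v where "k \<noteq> 0" "lin_sol \<mu> e (\<omega>\<^sup>2) (decaying_solution at_bot \<mu> e \<omega>) v"
    "decaying_solution at_bot \<mu> e \<omega> x0 = k * zeta \<mu> x0 e (\<omega>\<^sup>2)" "v x0 = - k"
proof -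
  let ?u = "decaying_solution at_bot \<mu> e \<omega>"
  let ?p = "\<lambda>x. bloch_val \<mu> x0 e (\<omega>\<^sup>2) (2 * x0 - x)"
  let ?q = "\<lambda>x. - bloch_flux \<mu> x0 e (\<omega>\<^sup>2) (2 * x0 - x)"
  have pq: "lin_sol \<mu> e (\<omega>\<^sup>2) ?p ?q" by (rule lin_sol_reflect[OF e lin_sol_bloch[OF e]])
  have lim: "(?p \<longlongrightarrow> 0) at_bot" "(?q \<longlongrightarrow> 0) at_bot"
    using bloch_tendsto_0[OF e gap, THEN filterlim_compose, OF filterlim_reflect_at_bot]
    by (auto simp: tendsto_minus_cancel_left[symmetric] dest: tendsto_minus)
  obtain y where "bloch_val \<mu> x0 e (\<omega>\<^sup>2) y \<noteq> 0" using bloch_nonzero[OF e] by metis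
  then have "?p (2 * x0 - y) \<noteq> 0" by simp
  then have "nonzero_solution \<mu> e \<omega> ?p \<and> decays at_bot e ?p"
    using is_solution_iff_lin_sol[OF e \<open>\<mu> > 0\<close>] pq decays_if_flux_tendsto_0[OF e pq lim]
    unfolding nonzero_solution_def by blast
  then have u: "nonzero_solution \<mu> e \<omega> ?u \<and> decays at_bot e ?u"
    unfolding decaying_solution_def by (rule someI[of "\<lambda>u. nonzero_solution \<mu> e \<omega> u \<and> decays _ e u"])
  then obtain v where uv: "lin_sol \<mu> e (\<omega>\<^sup>2) ?u v"
    using is_solution_iff_lin_sol[OF e \<open>\<mu> > 0\<close>] by (auto simp: nonzero_solution_def)
  have "(?u \<longlongrightarrow> 0) at_bot" using u by (simp add: decays_def)
  then have "((\<lambda>x. ?u (2 * x0 - x)) \<longlongrightarrow> 0) at_top"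
    by (rule filterlim_compose[OF _ filterlim_reflect_at_top])
  from tendsto_0_imp_bloch[OF e gap lin_sol_reflect[OF e uv] this] obtain k where
    k: "\<And>x. ?u (2 * x0 - x) = k * bloch_val \<mu> x0 e (\<omega>\<^sup>2) x"
       "\<And>x. - v (2 * x0 - x) = k * bloch_flux \<mu> x0 e (\<omega>\<^sup>2) x"
    by metis
  obtain y where "?u y \<noteq> 0" using u by (auto simp: nonzero_solution_def)
  then have "k \<noteq> 0" using k(1)[of "2 * x0 - y"] by auto
  have "- v x0 = k" using k(2)[of x0] bloch_flux_init[OF e] by simp
  then have "v x0 = - k" by (metis minus_minus)
  with \<open>k \<noteq> 0\<close> show ?thesis
    using k(1)[of x0] bloch_val_init[OF e] uv by (intro that[of k v]) simp_all
qed

text \<open>The arbitrary factors \<open>k\<close> and \<open>l\<close> cancel in the impedances.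
  The fluxes at \<open>x0\<close> are \<open>- k\<close> and \<open>l\<close>, so both surface
  impedances are finite throughout the gap.\<close>

lemma interface_impedance_root_iff:
  assumes eA: "permittivity x0 eA" and eB: "permittivity x0 eB" and "\<mu> > 0"
    and gap: "\<omega> \<in> common_band_gap \<mu> eA eB"
  shows "interface_impedance_root \<mu> x0 eA eB \<omega> \<longleftrightarrow>
    zeta \<mu> x0 eA (\<omega>\<^sup>2) + zeta \<mu> x0 eB (\<omega>\<^sup>2) = 0"
proof -
  have gapA: "norm (multiplier \<mu> x0 eA (\<omega>\<^sup>2)) < 1" and gapB: "norm (multiplier \<mu> x0 eB (\<omega>\<^sup>2)) < 1"
    using gap gap_iff[OF eA eB \<open>\<mu> > 0\<close>] by auto
  obtain k v where A: "k \<noteq> 0" "lin_sol \<mu> eA (\<omega>\<^sup>2) (decaying_solution at_bot \<mu> eA \<omega>) v"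
    "decaying_solution at_bot \<mu> eA \<omega> x0 = k * zeta \<mu> x0 eA (\<omega>\<^sup>2)" "v x0 = - k"
    by (rule decaying_solution_at_bot[OF eA \<open>\<mu> > 0\<close> gapA]) (rule that)
  obtain l w where B: "l \<noteq> 0" "lin_sol \<mu> eB (\<omega>\<^sup>2) (decaying_solution at_top \<mu> eB \<omega>) w"
    "decaying_solution at_top \<mu> eB \<omega> x0 = l * zeta \<mu> x0 eB (\<omega>\<^sup>2)" "w x0 = l"
    by (rule decaying_solution_at_top[OF eB \<open>\<mu> > 0\<close> gapB]) (rule that)
  have "flux_A \<mu> x0 eA \<omega> = - k" "impedance_A \<mu> x0 eA \<omega> = zeta \<mu> x0 eA (\<omega>\<^sup>2)"
    using one_sided_flux_eq[OF eA A(2), of "at_left x0" x0] A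
    by (simp_all add: flux_A_def impedance_A_def)
  moreover have "flux_B \<mu> x0 eB \<omega> = l" "impedance_B \<mu> x0 eB \<omega> = zeta \<mu> x0 eB (\<omega>\<^sup>2)"
    using one_sided_flux_eq[OF eB B(2), of "at_right x0" x0] B
    by (simp_all add: flux_B_def impedance_B_def)
  ultimately show ?thesis
    using A(1) B(1) by (simp add: interface_impedance_root_def interface_impedance_def)
qed

subsection \<open>Dependence on the permittivity and the frequency\<close>

text \<open>At a maximum of \<open>g\<close> against the weight
  \<open>exp (- (2 * L * (s - x0)))\<close> the integral term is at most half of \<open>g\<close>,
  because the rate is \<open>2 * L\<close>, and can be absorbed; this is the origin of the factor
  \<open>2\<close> in front of \<open>c\<close>.\<close>

lemma gronwall_unit_interval:
  fixes g :: "real \<Rightarrow> real"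
  assumes cont: "continuous_on {x0..x0+1} g" and "L > 0"
    and nonneg: "\<And>x. x \<in> {x0..x0+1} \<Longrightarrow> 0 \<le> g x"
    and le: "\<And>x. x \<in> {x0..x0+1} \<Longrightarrow> g x \<le> c + L * integral {x0..x} g"
    and x: "x \<in> {x0..x0+1}"
  shows "g x \<le> 2 * c * exp (2 * L)"
proof -
  have "\<exists>y\<in>{x0..x0+1}. \<forall>s\<in>{x0..x0+1}. exp (- (2 * L * (s - x0))) * g s \<le> exp (- (2 * L * (y - x0))) * g y"
    by (rule continuous_attains_sup) (auto intro!: continuous_intros cont)
  then obtain y where y: "y \<in> {x0..x0+1}"
    "\<And>s. s \<in> {x0..x0+1} \<Longrightarrow> exp (- (2 * L * (s - x0))) * g s \<le> exp (- (2 * L * (y - x0))) * g y"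
    by blast
  define m where "m = exp (- (2 * L * (y - x0))) * g y"
  define E where "E = exp (2 * L * (y - x0))"
  have m: "0 \<le> m" unfolding m_def using nonneg[OF y(1)] by simp
  have E: "1 \<le> E" unfolding E_def using y(1) \<open>L > 0\<close> by simp
  have "m = g y / E" by (simp add: m_def E_def exp_minus divide_inverse mult.commute)
  then have gy: "g y = m * E" using E by simp
  have g_le: "g s \<le> m * exp (2 * L * (s - x0))" if "s \<in> {x0..x0+1}" for s
  proof -
    have "g s / exp (2 * L * (s - x0)) \<le> m"
      using y(2)[OF that] by (simp add: m_def exp_minus divide_inverse mult.commute)
    then show ?thesis by (simp add: pos_divide_le_eq)
  qed
  have I: "((\<lambda>s. m * exp (2 * L * (s - x0))) has_integral
      m / (2 * L) * exp (2 * L * (y - x0)) - m / (2 * L) * exp (2 * L * (x0 - x0))) {x0..y}"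
    using y(1) \<open>L > 0\<close>
    by (intro fundamental_theorem_of_calculus)
       (auto intro!: derivative_eq_intros simp flip: has_real_derivative_iff_has_vector_derivative)
  have "g integrable_on {x0..y}"
    using y(1) by (intro integrable_continuous_interval continuous_on_subset[OF cont]) auto
  then have "integral {x0..y} g \<le> integral {x0..y} (\<lambda>s. m * exp (2 * L * (s - x0)))"
    using I y(1) g_le by (intro integral_le) auto
  also have "\<dots> = m / (2 * L) * (E - 1)"
    unfolding integral_unique[OF I] E_def by (simp add: algebra_simps)
  finally have "L * integral {x0..y} g \<le> L * (m / (2 * L) * (E - 1))"
    using \<open>L > 0\<close> by (intro mult_left_mono) auto
  also have "\<dots> = m * E / 2 - m / 2" using \<open>L > 0\<close> by (simp add: field_simps)
  finally have "m * E \<le> 2 * c" using le[OF y(1)] gy m by linarith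
  then have "m \<le> 2 * c" using mult_left_mono[OF E m] by simp
  moreover have "exp (2 * L * (x - x0)) \<le> exp (2 * L)" using x \<open>L > 0\<close> by simp
  ultimately have "m * exp (2 * L * (x - x0)) \<le> 2 * c * exp (2 * L)"
    using m by (intro mult_mono) auto
  then show ?thesis using g_le[OF x] by simp
qed

text \<open>The products are split so that \<open>C\<close> and \<open>Z\<close> bound only the
  perturbed coefficients and \<open>B\<close> only the unperturbed solution; no a priori bound on
  \<open>u\<close> and \<open>v\<close> enters.\<close>

lemma lin_sol_dist:
  assumes e: "permittivity x0 e" and e0: "permittivity x0 e0" and "\<mu> > 0"
    and uv: "lin_sol \<mu> e z u v" and uv0: "lin_sol \<mu> e0 z0 u0 v0"
    and dist: "\<And>x. norm (e x - e0 x) \<le> \<eta>" and C: "\<And>x. norm (e x) \<le> C" and Z: "norm z \<le> Z"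
    and B: "\<And>x. x \<in> {x0..x0+1} \<Longrightarrow> norm (u0 x) \<le> B" "\<And>x. x \<in> {x0..x0+1} \<Longrightarrow> norm (v0 x) \<le> B"
    and x: "x \<in> {x0..x0+1}"
  shows "norm (u x - u0 x) + norm (v x - v0 x) \<le>
    2 * (norm (u x0 - u0 x0) + norm (v x0 - v0 x0) + (\<eta> + \<mu> * norm (z - z0)) * B) * exp (2 * (C + \<mu> * Z))"
proof -
  define L where "L = C + \<mu> * Z"
  have "C > 0"
    using C[of x0] permittivity_nonzero[OF e, of x0] by (smt (verit) zero_less_norm_iff)
  moreover have "Z \<ge> 0" using Z norm_ge_zero order_trans by blast
  ultimately have L: "L > 0" "C \<le> L" "\<mu> * Z \<le> L" using \<open>\<mu> > 0\<close> by (auto simp: L_def add_pos_nonneg)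
  define D where "D = (\<eta> + \<mu> * norm (z - z0)) * B"
  have B0: "B \<ge> 0" using B(1)[OF x] norm_ge_zero order_trans by blast
  have \<eta>: "\<eta> \<ge> 0" using dist[of x] norm_ge_zero order_trans by blast
  have D: "D \<ge> 0" using B0 \<eta> \<open>\<mu> > 0\<close> by (simp add: D_def)
  define g where "g s = norm (u s - u0 s) + norm (v s - v0 s)" for s
  define hu where "hu s = C * norm (v s - v0 s) + \<eta> * B" for s
  define hv where "hv s = \<mu> * Z * norm (u s - u0 s) + \<mu> * norm (z - z0) * B" for s
  have cont: "continuous_on S g" "continuous_on S hu" "continuous_on S hv" for S
    unfolding g_def hu_def hv_def
    by (intro continuous_intros lin_solD(1,2)[OF uv] lin_solD(1,2)[OF uv0])+
  have int: "g integrable_on {a..b}" "hu integrable_on {a..b}" "hv integrable_on {a..b}" for a b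
    using cont by (auto intro: integrable_continuous_interval)
  have "g x \<le> 2 * (g x0 + D) * exp (2 * L)"
  proof (rule gronwall_unit_interval[OF cont(1) L(1) _ _ x])
    fix y assume y: "y \<in> {x0..x0+1}"
    then have "x0 \<le> y" by simp
    note I = has_integral_diff[OF lin_sol_has_integral(1)[OF e uv this] lin_sol_has_integral(1)[OF e0 uv0 this]]
      has_integral_diff[OF lin_sol_has_integral(2)[OF e uv this] lin_sol_has_integral(2)[OF e0 uv0 this]]
    have "norm ((u y - u x0) - (u0 y - u0 x0)) \<le> integral {x0..y} hu"
      unfolding integral_unique[OF I(1), symmetric]
    proof (rule integral_norm_bound_integral[OF has_integral_integrable[OF I(1)] int(2)])
      fix s assume s: "s \<in> {x0..y}"
      have "e s * v s - e0 s * v0 s = e s * (v s - v0 s) + (e s - e0 s) * v0 s"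
        by (simp add: algebra_simps)
      then have "norm (e s * v s - e0 s * v0 s) \<le> norm (e s) * norm (v s - v0 s) + norm (e s - e0 s) * norm (v0 s)"
        by (metis norm_mult norm_triangle_ineq)
      also have "\<dots> \<le> hu s"
        unfolding hu_def using C[of s] dist[of s] B(2)[of s] s y B0 \<eta> \<open>C > 0\<close>
        by (intro add_mono mult_mono) auto
      finally show "norm (e s * v s - e0 s * v0 s) \<le> hu s" .
    qed
    moreover have "norm ((v y - v x0) - (v0 y - v0 x0)) \<le> integral {x0..y} hv"
      unfolding integral_unique[OF I(2), symmetric]
    proof (rule integral_norm_bound_integral[OF has_integral_integrable[OF I(2)] int(3)])
      fix s assume s: "s \<in> {x0..y}"
      have "- (of_real \<mu> * z * u s) - - (of_real \<mu> * z0 * u0 s) =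
          - (of_real \<mu> * z * (u s - u0 s) + of_real \<mu> * (z - z0) * u0 s)"
        by (simp add: algebra_simps)
      then have "norm (- (of_real \<mu> * z * u s) - - (of_real \<mu> * z0 * u0 s))
          \<le> norm (of_real \<mu> * z * (u s - u0 s)) + norm (of_real \<mu> * (z - z0) * u0 s)"
        by (metis norm_minus_cancel norm_triangle_ineq)
      also have "\<dots> = \<mu> * norm z * norm (u s - u0 s) + \<mu> * norm (z - z0) * norm (u0 s)"
        using \<open>\<mu> > 0\<close> by (simp add: norm_mult)
      also have "\<dots> \<le> hv s"
        unfolding hv_def using Z B(1)[of s] s y B0 \<open>\<mu> > 0\<close> \<open>Z \<ge> 0\<close>
        by (intro add_mono mult_mono) auto
      finally show "norm (- (of_real \<mu> * z * u s) - - (of_real \<mu> * z0 * u0 s)) \<le> hv s" .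
    qed
    moreover have "integral {x0..y} hu + integral {x0..y} hv \<le> L * integral {x0..y} g + D"
    proof -
      have "integral {x0..y} hu + integral {x0..y} hv = integral {x0..y} (\<lambda>s. hu s + hv s)"
        by (rule Henstock_Kurzweil_Integration.integral_add[OF int(2,3), symmetric])
      also have "\<dots> \<le> integral {x0..y} (\<lambda>s. L * g s + D)"
      proof (rule integral_le)
        fix s
        have "C * norm (v s - v0 s) \<le> L * norm (v s - v0 s)"
          "\<mu> * Z * norm (u s - u0 s) \<le> L * norm (u s - u0 s)"
          using L by (auto intro: mult_right_mono)
        then show "hu s + hv s \<le> L * g s + D"
          by (simp add: hu_def hv_def g_def D_def algebra_simps)
      qed (use cont in \<open>auto intro!: integrable_continuous_interval continuous_intros\<close>)
      also have "\<dots> = L * integral {x0..y} g + D * (y - x0)"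
        using int(1) \<open>x0 \<le> y\<close>
        by (subst Henstock_Kurzweil_Integration.integral_add) (auto intro!: integrable_continuous_interval continuous_intros cont)
      also have "D * (y - x0) \<le> D * 1" using D y by (intro mult_left_mono) auto
      finally show ?thesis by simp
    qed
    moreover have "norm (u y - u0 y) \<le> norm (u x0 - u0 x0) + norm ((u y - u x0) - (u0 y - u0 x0))"
      "norm (v y - v0 y) \<le> norm (v x0 - v0 x0) + norm ((v y - v x0) - (v0 y - v0 x0))"
      by norm+
    ultimately show "g y \<le> g x0 + D + L * integral {x0..y} g" unfolding g_def by linarith
  qed (simp add: g_def)
  then show ?thesis by (simp add: g_def D_def L_def)
qed

text \<open>The filter is arbitrary because two kinds of limits are needed: in
  \<open>\<delta>\<close> alone, and in \<open>\<delta>\<close> jointly with two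
  frequencies.\<close>

lemma lin_sol_uniform_limit:
  assumes e0: "permittivity x0 e0" and e: "\<And>i. permittivity x0 (e i)" and "\<mu> > 0"
    and dist: "\<And>i x. norm (e i x - e0 x) \<le> b i" and b: "(b \<longlongrightarrow> 0) F" and z: "(z \<longlongrightarrow> z0) F"
    and uv: "\<And>i. lin_sol \<mu> (e i) (z i) (u i) (v i)" and uv0: "lin_sol \<mu> e0 z0 u0 v0"
    and init: "((\<lambda>i. u i x0) \<longlongrightarrow> u0 x0) F" "((\<lambda>i. v i x0) \<longlongrightarrow> v0 x0) F"
  shows "uniform_limit {x0..x0+1} u u0 F" "uniform_limit {x0..x0+1} v v0 F"
proof -
  obtain C where C: "\<And>x. norm (e0 x) \<le> C" using permittivity_bounded[OF e0] by blast
  have "bounded (u0 ` {x0..x0+1})" "bounded (v0 ` {x0..x0+1})"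
    using lin_solD(1,2)[OF uv0] by (auto intro!: compact_imp_bounded compact_continuous_image)
  then obtain B1 B2 where "\<And>x. x \<in> {x0..x0+1} \<Longrightarrow> norm (u0 x) \<le> B1" "\<And>x. x \<in> {x0..x0+1} \<Longrightarrow> norm (v0 x) \<le> B2"
    unfolding bounded_iff by (metis imageI)
  then have B: "\<And>x. x \<in> {x0..x0+1} \<Longrightarrow> norm (u0 x) \<le> max B1 B2" "\<And>x. x \<in> {x0..x0+1} \<Longrightarrow> norm (v0 x) \<le> max B1 B2"
    by (auto simp: le_max_iff_disj)
  \<comment> \<open>The bounds \<open>C + 1\<close> and \<open>norm z0 + 1\<close> hold for the
    perturbed data eventually along \<open>F\<close>, once \<open>b i < 1\<close> and
    \<open>z i\<close> is close to \<open>z0\<close>.\<close>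
  define R where "R i = 2 * (norm (u i x0 - u0 x0) + norm (v i x0 - v0 x0) +
    (b i + \<mu> * norm (z i - z0)) * max B1 B2) * exp (2 * ((C + 1) + \<mu> * (norm z0 + 1)))" for i
  have "(R \<longlongrightarrow> 2 * (norm (u0 x0 - u0 x0) + norm (v0 x0 - v0 x0) +
    (0 + \<mu> * norm (z0 - z0)) * max B1 B2) * exp (2 * ((C + 1) + \<mu> * (norm z0 + 1)))) F"
    unfolding R_def by (intro tendsto_intros init b z)
  then have R: "(R \<longlongrightarrow> 0) F" by simp
  have "\<forall>\<^sub>F i in F. b i < 1" using b by (rule order_tendstoD) simp
  moreover have "\<forall>\<^sub>F i in F. norm (z i) < norm z0 + 1"
    using tendsto_norm[OF z] by (rule order_tendstoD) simp
  ultimately have bnd: "\<forall>\<^sub>F i in F. \<forall>x\<in>{x0..x0+1}. norm (u i x - u0 x) + norm (v i x - v0 x) \<le> R i"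
  proof eventually_elim
    case (elim i)
    have "norm (e i x) \<le> C + 1" for x
      using dist[of i x] C[of x] elim(1) norm_triangle_ineq2[of "e i x" "e0 x"] by linarith
    then show ?case
      unfolding R_def using elim(2)
      by (intro ballI lin_sol_dist[OF e e0 \<open>\<mu> > 0\<close> uv uv0 dist] B) auto
  qed
  have near: "\<forall>\<^sub>F i in F. \<forall>x\<in>{x0..x0+1}. norm (u i x - u0 x) + norm (v i x - v0 x) < \<epsilon>" if "\<epsilon> > 0" for \<epsilon>
    using bnd order_tendstoD(2)[OF R that] by eventually_elim force
  have *: "\<forall>\<^sub>F i in F. \<forall>x\<in>{x0..x0+1}. norm (u i x - u0 x) < \<epsilon> \<and> norm (v i x - v0 x) < \<epsilon>" if "\<epsilon> > 0" for \<epsilon>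
    using near[OF that] by eventually_elim (smt (verit) norm_ge_zero)
  show "uniform_limit {x0..x0+1} u u0 F" "uniform_limit {x0..x0+1} v v0 F"
    unfolding uniform_limit_iff dist_norm using * by (fast elim: eventually_mono)+
qed

lemma monodromy_tendsto:
  assumes e0: "permittivity x0 e0" and e: "\<And>i. permittivity x0 (e i)" and "\<mu> > 0"
    and dist: "\<And>i x. norm (e i x - e0 x) \<le> b i" and b: "(b \<longlongrightarrow> 0) F" and z: "(z \<longlongrightarrow> z0) F"
  shows "((\<lambda>i. mono_diag \<mu> x0 (e i) (z i)) \<longlongrightarrow> mono_diag \<mu> x0 e0 z0) F"
    and "((\<lambda>i. mono_low \<mu> x0 (e i) (z i)) \<longlongrightarrow> mono_low \<mu> x0 e0 z0) F"
proof -
  have "uniform_limit {x0..x0+1} (\<lambda>i. ivp_val \<mu> x0 (e i) (z i) 1 0) (ivp_val \<mu> x0 e0 z0 1 0) F"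
    "uniform_limit {x0..x0+1} (\<lambda>i. ivp_flux \<mu> x0 (e i) (z i) 1 0) (ivp_flux \<mu> x0 e0 z0 1 0) F"
    using lin_sol_uniform_limit[OF e0 e \<open>\<mu> > 0\<close> dist b z lin_sol_ivp[OF e] lin_sol_ivp[OF e0]]
    by (simp_all add: ivp_val_init[OF e0] ivp_val_init[OF e] ivp_flux_init[OF e0] ivp_flux_init[OF e])
  from this[THEN tendsto_uniform_limitI, of "x0 + 1"]
  show "((\<lambda>i. mono_diag \<mu> x0 (e i) (z i)) \<longlongrightarrow> mono_diag \<mu> x0 e0 z0) F"
    "((\<lambda>i. mono_low \<mu> x0 (e i) (z i)) \<longlongrightarrow> mono_low \<mu> x0 e0 z0) F"
    by (simp_all add: mono_diag_def mono_low_def)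
qed

text \<open>The perturbed problem may lie outside the gap, and its multiplier is a choice between
  two roots. Still, \<open>norm m \<le> 1\<close> keeps \<open>m0 * m\<close> at distance at least
  \<open>1 - norm m0\<close> from \<open>1\<close>, so \<open>m\<close> cannot approach the
  reciprocal of \<open>m0\<close>; eliminating as in \<open>multiplier_characterization\<close> now
  leaves \<open>2 * (a - a0) * (m * m0)\<close>.\<close>

lemma multiplier_dist:
  assumes "norm (multiplier \<mu> x0 e0 z0) < 1"
  shows "norm (multiplier \<mu> x0 e z - multiplier \<mu> x0 e0 z0) \<le>
    2 * norm (mono_diag \<mu> x0 e z - mono_diag \<mu> x0 e0 z0) / (1 - norm (multiplier \<mu> x0 e0 z0))"
proof -
  define m where "m = multiplier \<mu> x0 e z"
  define m0 where "m0 = multiplier \<mu> x0 e0 z0"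
  define a where "a = mono_diag \<mu> x0 e z"
  define a0 where "a0 = mono_diag \<mu> x0 e0 z0"
  have eqs: "m\<^sup>2 - 2 * a * m + 1 = 0" "m0\<^sup>2 - 2 * a0 * m0 + 1 = 0" and m: "norm m \<le> 1"
    using multiplier by (simp_all add: m_def a_def m0_def a0_def)
  have m0: "norm m0 < 1" using assms by (simp add: m0_def)
  have "(m - m0) * (m0 * m - 1) - 2 * (a - a0) * (m * m0) =
      m0 * (m\<^sup>2 - 2 * a * m + 1) - m * (m0\<^sup>2 - 2 * a0 * m0 + 1)"
    by (simp add: power2_eq_square algebra_simps)
  then have "(m - m0) * (m0 * m - 1) = 2 * (a - a0) * (m * m0)" using eqs by simp
  then have "norm (m - m0) * norm (m0 * m - 1) = 2 * norm (a - a0) * (norm m * norm m0)"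
    by (metis norm_mult norm_numeral)
  also have "\<dots> \<le> 2 * norm (a - a0) * (1 * 1)"
    using m m0 by (intro mult_left_mono mult_mono) auto
  finally have le: "norm (m - m0) * norm (m0 * m - 1) \<le> 2 * norm (a - a0)" by simp
  have "1 - norm m0 \<le> 1 - norm (m0 * m)"
    using m mult_left_mono[OF m, of "norm m0"] by (simp add: norm_mult)
  also have "\<dots> \<le> norm (m0 * m - 1)"
    using norm_triangle_ineq2[of 1 "m0 * m"] by (simp add: norm_minus_commute)
  finally have "norm (m - m0) * (1 - norm m0) \<le> norm (m - m0) * norm (m0 * m - 1)"
    by (intro mult_left_mono) auto
  with le have "norm (m - m0) * (1 - norm m0) \<le> 2 * norm (a - a0)" by simp
  then show ?thesis using m0 by (simp add: m_def m0_def a_def a0_def field_simps)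
qed

text \<open>Convergence is passed on from the monodromy entries to the multiplier, then to
  \<open>zeta\<close>, which is the initial value of the Bloch solution, and so to the solution
  itself. The gap condition on the limit problem keeps the denominators away from zero.\<close>

lemma bloch_data_tendsto:
  assumes e0: "permittivity x0 e0" and e: "\<And>i. permittivity x0 (e i)" and "\<mu> > 0"
    and dist: "\<And>i x. norm (e i x - e0 x) \<le> b i" and b: "(b \<longlongrightarrow> 0) F" and z: "(z \<longlongrightarrow> z0) F"
    and gap: "norm (multiplier \<mu> x0 e0 z0) < 1"
  shows multiplier_tendsto: "((\<lambda>i. multiplier \<mu> x0 (e i) (z i)) \<longlongrightarrow> multiplier \<mu> x0 e0 z0) F"
    and zeta_tendsto: "((\<lambda>i. zeta \<mu> x0 (e i) (z i)) \<longlongrightarrow> zeta \<mu> x0 e0 z0) F"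
    and bloch_val_uniform_limit:
      "uniform_limit {x0..x0+1} (\<lambda>i. bloch_val \<mu> x0 (e i) (z i)) (bloch_val \<mu> x0 e0 z0) F"
proof -
  note mono = monodromy_tendsto[OF e0 e \<open>\<mu> > 0\<close> dist b z]
  have "((\<lambda>i. 2 * norm (mono_diag \<mu> x0 (e i) (z i) - mono_diag \<mu> x0 e0 z0) / (1 - norm (multiplier \<mu> x0 e0 z0)))
      \<longlongrightarrow> 2 * norm (mono_diag \<mu> x0 e0 z0 - mono_diag \<mu> x0 e0 z0) / (1 - norm (multiplier \<mu> x0 e0 z0))) F"
    using gap by (intro tendsto_intros mono) auto
  then have "((\<lambda>i. multiplier \<mu> x0 (e i) (z i) - multiplier \<mu> x0 e0 z0) \<longlongrightarrow> 0) F"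
    by (intro Lim_null_comparison[OF always_eventually[OF allI[OF multiplier_dist[OF gap]]]]) simp
  then show mult: "((\<lambda>i. multiplier \<mu> x0 (e i) (z i)) \<longlongrightarrow> multiplier \<mu> x0 e0 z0) F"
    by (simp add: LIM_zero_iff)
  show zeta: "((\<lambda>i. zeta \<mu> x0 (e i) (z i)) \<longlongrightarrow> zeta \<mu> x0 e0 z0) F"
    unfolding zeta_def by (intro tendsto_intros mult mono mono_low_nonzero[OF e0 gap])
  show "uniform_limit {x0..x0+1} (\<lambda>i. bloch_val \<mu> x0 (e i) (z i)) (bloch_val \<mu> x0 e0 z0) F"
    by (rule lin_sol_uniform_limit(1)[OF e0 e \<open>\<mu> > 0\<close> dist b z lin_sol_bloch[OF e] lin_sol_bloch[OF e0]])
       (simp_all add: bloch_val_init[OF e0] bloch_val_init[OF e] bloch_flux_init[OF e0]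
          bloch_flux_init[OF e] zeta)
qed

section \<open>The divided difference of the surface impedance\<close>

definition zeta_quot :: "real \<Rightarrow> real \<Rightarrow> (real \<Rightarrow> complex) \<Rightarrow> complex \<Rightarrow> complex \<Rightarrow> complex" where
  "zeta_quot \<mu> x0 e z1 z2 =
     - of_real \<mu> * integral {x0..x0+1} (\<lambda>x. bloch_val \<mu> x0 e z1 x * bloch_val \<mu> x0 e z2 x) /
       (1 - multiplier \<mu> x0 e z1 * multiplier \<mu> x0 e z2)"

lemma mult_norm_less_1:
  fixes m n :: complex
  assumes "norm m < 1" "norm n < 1"
  shows "1 - m * n \<noteq> 0"
proof
  assume "1 - m * n = 0"
  then have "norm m * norm n = 1" by (metis eq_iff_diff_eq_0 norm_mult norm_one)
  moreover have "norm m * norm n \<le> norm m * 1" using assms by (intro mult_left_mono) auto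
  ultimately show False using assms by simp
qed

text \<open>Over one period the Wronskian of the two Bloch solutions is multiplied by the product of
  their multipliers, and the unit fluxes reduce it at \<open>x0\<close> to the difference of the
  \<open>zeta\<close> values. The quotient has no \<open>z1 - z2\<close> in its denominator, so it
  keeps its meaning on the diagonal.\<close>

lemma zeta_diff:
  assumes e: "permittivity x0 e"
    and gap: "norm (multiplier \<mu> x0 e z1) < 1" "norm (multiplier \<mu> x0 e z2) < 1"
  shows "zeta \<mu> x0 e z1 - zeta \<mu> x0 e z2 = (z1 - z2) * zeta_quot \<mu> x0 e z1 z2"
proof -
  define M where "M = multiplier \<mu> x0 e z1 * multiplier \<mu> x0 e z2"
  define J where "J = integral {x0..x0+1} (\<lambda>x. bloch_val \<mu> x0 e z1 x * bloch_val \<mu> x0 e z2 x)"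
  have J: "((\<lambda>x. bloch_val \<mu> x0 e z1 x * bloch_val \<mu> x0 e z2 x) has_integral J) {x0..x0+1}"
    unfolding J_def
    by (intro integrable_integral integrable_continuous_interval continuous_intros
        lin_solD(1)[OF lin_sol_bloch[OF e]])
  have "1 - M \<noteq> 0" unfolding M_def by (rule mult_norm_less_1[OF gap])
  have "of_real \<mu> * (z1 - z2) * J = (M - 1) * (zeta \<mu> x0 e z1 - zeta \<mu> x0 e z2)"
    using has_integral_unique[OF has_integral_mult_right[OF J]
        lagrange_identity[OF e lin_sol_bloch[OF e] lin_sol_bloch[OF e]]]
    unfolding bloch_shift[OF e gap(1)] bloch_shift[OF e gap(2)] bloch_val_init[OF e] bloch_flux_init[OF e]
    by (simp add: M_def algebra_simps)
  then have "(1 - M) * (zeta \<mu> x0 e z1 - zeta \<mu> x0 e z2) = (z1 - z2) * (- of_real \<mu> * J)"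
    by (simp add: algebra_simps)
  then show ?thesis
    using \<open>1 - M \<noteq> 0\<close> unfolding zeta_quot_def M_def[symmetric] J_def[symmetric]
    by (metis nonzero_mult_div_cancel_left times_divide_eq_right)
qed

text \<open>Uniform convergence on one period passes to the product, as the limit is bounded, and
  from there to the integral.\<close>

lemma zeta_quot_tendsto:
  assumes e0: "permittivity x0 e0" and e: "\<And>i. permittivity x0 (e i)" and "\<mu> > 0"
    and dist: "\<And>i x. norm (e i x - e0 x) \<le> b i" and b: "(b \<longlongrightarrow> 0) F"
    and z: "(z1 \<longlongrightarrow> z0) F" "(z2 \<longlongrightarrow> z0) F"
    and gap: "norm (multiplier \<mu> x0 e0 z0) < 1" and F: "F \<noteq> bot"
  shows "((\<lambda>i. zeta_quot \<mu> x0 (e i) (z1 i) (z2 i)) \<longlongrightarrow> zeta_quot \<mu> x0 e0 z0 z0) F"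
proof -
  note lim = bloch_data_tendsto[OF e0 e \<open>\<mu> > 0\<close> dist b z(1) gap] bloch_data_tendsto[OF e0 e \<open>\<mu> > 0\<close> dist b z(2) gap]
  have cont: "continuous_on S (bloch_val \<mu> x0 (e i) w)" "continuous_on S (bloch_val \<mu> x0 e0 w)" for S i w
    using lin_solD(1)[OF lin_sol_bloch] e e0 by blast+
  have "bounded (bloch_val \<mu> x0 e0 z0 ` {x0..x0+1})"
    by (intro compact_imp_bounded compact_continuous_image cont) auto
  then have "uniform_limit {x0..x0+1} (\<lambda>i x. bloch_val \<mu> x0 (e i) (z1 i) x * bloch_val \<mu> x0 (e i) (z2 i) x)
      (\<lambda>x. bloch_val \<mu> x0 e0 z0 x * bloch_val \<mu> x0 e0 z0 x) F"
    by (intro uniform_lim_mult lim)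
  then obtain I J where IJ:
    "\<And>i. ((\<lambda>x. bloch_val \<mu> x0 (e i) (z1 i) x * bloch_val \<mu> x0 (e i) (z2 i) x) has_integral I i) {x0..x0+1}"
    "((\<lambda>x. bloch_val \<mu> x0 e0 z0 x * bloch_val \<mu> x0 e0 z0 x) has_integral J) {x0..x0+1}"
    "(I \<longlongrightarrow> J) F"
    by (rule uniform_limit_integral[OF _ _ F]) (auto intro!: continuous_intros cont)
  show ?thesis
    unfolding zeta_quot_def integral_unique[OF IJ(1)] integral_unique[OF IJ(2)]
    by (intro tendsto_intros IJ(3) lim mult_norm_less_1 gap)
qed

section \<open>Positivity and the undamped problem\<close>

lemma bloch_energy_pos:
  assumes e: "permittivity x0 e" and gap: "norm (multiplier \<mu> x0 e z) < 1"
  obtains N where "N > 0"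
    "((\<lambda>x. bloch_val \<mu> x0 e z x * cnj (bloch_val \<mu> x0 e z x)) has_integral of_real N) {x0..x0+1}"
proof -
  define m where "m = multiplier \<mu> x0 e z"
  define u where "u = bloch_val \<mu> x0 e z"
  define N where "N = integral {x0..x0+1} (\<lambda>x. (norm (u x))\<^sup>2)"
  have cont: "continuous_on S u" for S
    unfolding u_def by (rule lin_solD(1)[OF lin_sol_bloch[OF e]])
  have shift: "u (x + 1) = m * u x" for x unfolding u_def m_def by (rule bloch_shift[OF e gap])
  have "m \<noteq> 0" using multiplier_root[of \<mu> x0 e z] by (auto simp: m_def)
  have I: "((\<lambda>x. (norm (u x))\<^sup>2) has_integral N) {x0..x0+1}"
    unfolding N_def by (intro integrable_integral integrable_continuous_interval continuous_intros cont)
  have "N \<ge> 0" using I by (rule has_integral_nonneg) simp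
  have "N \<noteq> 0"
  proof
    assume "N = 0"
    have zero: "u x = 0" if "x \<in> {x0..x0+1}" for x
    proof -
      have "(norm (u x))\<^sup>2 = 0"
      proof (rule has_integral_0_cbox_imp_0[of x0 "x0 + 1" "\<lambda>x. (norm (u x))\<^sup>2"])
        show "continuous_on (cbox x0 (x0 + 1)) (\<lambda>x. (norm (u x))\<^sup>2)" by (intro continuous_intros cont)
      qed (use I \<open>N = 0\<close> that in auto)
      then show ?thesis by simp
    qed
    obtain y where y: "u y \<noteq> 0" using bloch_nonzero[OF e] unfolding u_def by metis
    define n where "n = \<lfloor>y - x0\<rfloor>"
    define t where "t = y - of_int n"
    have "t \<in> {x0..x0+1}" unfolding t_def n_def by simp linarith
    then have "u t = 0" by (rule zero)
    \<comment> \<open>By now \<open>u\<close> vanishes on a whole period. Multiplication by powers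
      of \<open>m\<close> carries this to the right; to the left it needs division, hence
      \<open>m \<noteq> 0\<close>.\<close>
    show False
    proof (cases "n \<ge> 0")
      case True
      then have "u y = m ^ nat n * u t"
        using shift_power[of u m, OF shift, of t "nat n"] by (simp add: t_def)
      then show False using y \<open>u t = 0\<close> by simp
    next
      case False
      then have "u t = m ^ nat (- n) * u y"
        using shift_power[of u m, OF shift, of y "nat (- n)"] by (simp add: t_def)
      then show False using y \<open>u t = 0\<close> \<open>m \<noteq> 0\<close> by simp
    qed
  qed
  show ?thesis
  proof (rule that)
    show "N > 0" using \<open>N \<ge> 0\<close> \<open>N \<noteq> 0\<close> by simp
    show "((\<lambda>x. bloch_val \<mu> x0 e z x * cnj (bloch_val \<mu> x0 e z x)) has_integral of_real N) {x0..x0+1}"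
      using has_integral_linear[OF I bounded_linear_of_real[where ?'a = complex]]
      by (simp add: o_def flip: u_def complex_norm_square)
  qed
qed

text \<open>Self-adjointness of the undamped problem, applied to a Bloch solution and its conjugate.\<close>

lemma zeta_Im:
  assumes e: "permittivity x0 e" and "\<mu> > 0" and real: "\<And>x. e x \<in> \<real>"
    and gap: "norm (multiplier \<mu> x0 e z) < 1"
  obtains r where "r > 0" "Im (zeta \<mu> x0 e z) = - r * Im z"
proof -
  define m where "m = multiplier \<mu> x0 e z"
  define t where "t = zeta \<mu> x0 e z"
  note B = lin_sol_bloch[OF e, of \<mu> z]
  obtain N where N: "N > 0"
    "((\<lambda>x. bloch_val \<mu> x0 e z x * cnj (bloch_val \<mu> x0 e z x)) has_integral of_real N) {x0..x0+1}"
    using bloch_energy_pos[OF e gap] .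
  \<comment> \<open>The conjugate solution has parameter \<open>cnj z\<close>, multiplier
    \<open>cnj m\<close> and value \<open>cnj t\<close> at \<open>x0\<close>. Both sides are purely
    imaginary, so nothing is lost in comparing imaginary parts.\<close>
  have "of_real \<mu> * (z - cnj z) * of_real N = (m * cnj m - 1) * (t - cnj t)"
    using has_integral_unique[OF has_integral_mult_right[OF N(2)]
        lagrange_identity[OF e B lin_sol_cnj[OF real B], of x0 "x0 + 1"]]
    unfolding bloch_shift[OF e gap] bloch_val_init[OF e] bloch_flux_init[OF e]
    by (simp add: m_def t_def algebra_simps)
  also have "m * cnj m = of_real ((norm m)\<^sup>2)" by (rule complex_norm_square[symmetric])
  finally have "Im (of_real \<mu> * (z - cnj z) * of_real N) = Im ((of_real ((norm m)\<^sup>2) - 1) * (t - cnj t))"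
    by simp
  then have *: "\<mu> * N * Im z = - (1 - (norm m)\<^sup>2) * Im t" by (simp add: algebra_simps)
  have "(norm m)\<^sup>2 < 1" using gap by (simp add: m_def power_less_one_iff)
  then show ?thesis
    using N(1) \<open>\<mu> > 0\<close> * by (intro that[of "\<mu> * N / (1 - (norm m)\<^sup>2)"]) (auto simp: field_simps t_def)
qed

text \<open>For real \<open>z\<close> the value \<open>zeta\<close> is real by
  \<open>zeta_Im\<close>, so the Bloch solution has real data and equals its conjugate. The bilinear
  integral becomes the energy \<open>N > 0\<close>, and \<open>1 - m * m\<close> is positive because
  \<open>m\<close> is real as well.\<close>

lemma zeta_quot_negative:
  assumes e: "permittivity x0 e" and "\<mu> > 0" and real: "\<And>x. e x \<in> \<real>"
    and gap: "norm (multiplier \<mu> x0 e z) < 1" and z: "z \<in> \<real>"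
  obtains r where "r > 0" "zeta_quot \<mu> x0 e z z = - of_real r"
proof -
  define m where "m = multiplier \<mu> x0 e z"
  define u where "u = bloch_val \<mu> x0 e z"
  define v where "v = bloch_flux \<mu> x0 e z"
  have uv: "lin_sol \<mu> e z u v" "u x0 = zeta \<mu> x0 e z" "v x0 = 1"
    using bloch[OF e] by (simp_all add: u_def v_def)
  obtain N where N: "N > 0" "((\<lambda>x. u x * cnj (u x)) has_integral of_real N) {x0..x0+1}"
    unfolding u_def using bloch_energy_pos[OF e gap] .
  obtain r where "Im (zeta \<mu> x0 e z) = - r * Im z" using zeta_Im[OF e \<open>\<mu> > 0\<close> real gap] by metis
  then have "cnj (u x0) = u x0" using z uv(2) by (simp add: complex_eq_iff complex_is_Real_iff)
  moreover have "cnj z = z" using z by (simp add: Reals_cnj_iff)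
  ultimately have cnj: "cnj (u x) = u x \<and> cnj (v x) = v x" for x
    using lin_sol_unique[OF e lin_sol_cnj[OF real uv(1)], of u v x] uv by simp
  \<comment> \<open>With unit flux at \<open>x0\<close>, the multiplier is itself the flux at
    \<open>x0 + 1\<close>.\<close>
  have "v (x0 + 1) = m * v x0" unfolding v_def m_def by (rule bloch_shift[OF e gap])
  then have "cnj m = m" using cnj[of "x0 + 1"] uv(3) by simp
  then have "m * m = of_real ((norm m)\<^sup>2)" using complex_norm_square[of m] by simp
  moreover have "integral {x0..x0+1} (\<lambda>x. u x * u x) = of_real N"
    using integral_unique[OF N(2)] cnj by simp
  ultimately have "zeta_quot \<mu> x0 e z z = - of_real \<mu> * of_real N / (1 - of_real ((norm m)\<^sup>2))"
    unfolding zeta_quot_def u_def m_def by simp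
  also have "\<dots> = - of_real (\<mu> * N / (1 - (norm m)\<^sup>2))" by simp
  finally show ?thesis
    using N(1) \<open>\<mu> > 0\<close> gap
    by (intro that[of "\<mu> * N / (1 - (norm m)\<^sup>2)"]) (auto simp: m_def power_less_one_iff)
qed

text \<open>Constants with zero flux solve the system at \<open>z = 0\<close>, so the quadratic has
  the double root \<open>1\<close>. This is what keeps \<open>\<omega> = 0\<close> out of the
  gap.\<close>

lemma multiplier_0:
  assumes e: "permittivity x0 e"
  shows "multiplier \<mu> x0 e 0 = 1"
proof -
  have "lin_sol \<mu> e 0 (\<lambda>_. 1) (\<lambda>_. 0)" by (simp add: lin_sol_def)
  then have "ivp_val \<mu> x0 e 0 1 0 x = 1 \<and> ivp_flux \<mu> x0 e 0 1 0 x = 0" for x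
    by (rule lin_sol_unique[OF e lin_sol_ivp[OF e]]) (simp_all add: ivp_val_init[OF e] ivp_flux_init[OF e])
  then have "mono_diag \<mu> x0 e 0 = 1" by (simp add: mono_diag_def)
  then have "(multiplier \<mu> x0 e 0 - 1)\<^sup>2 = 0"
    using multiplier_root[of \<mu> x0 e 0] by (simp add: power2_eq_square algebra_simps)
  then show ?thesis by simp
qed

subsection \<open>Persistence of the interface mode\<close>

text \<open>The map \<open>w - f w / g\<close> uses the fixed slope \<open>g\<close>. The two-point
  bound makes it a contraction with factor \<open>1 / 2\<close>, and the smallness of
  \<open>f w0\<close> leaves the other \<open>r / 2\<close> needed to map the ball into itself. The
  second claim bounds the error independently of \<open>r\<close>, which yields convergence of the
  roots.\<close>

lemma simplified_newton_root:
  fixes f :: "complex \<Rightarrow> complex" and g w0 :: complex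
  assumes "g \<noteq> 0" "r > 0"
    and lip: "\<And>w1 w2. w1 \<in> cball w0 r \<Longrightarrow> w2 \<in> cball w0 r \<Longrightarrow>
      norm (f w1 - f w2 - g * (w1 - w2)) \<le> norm g / 2 * norm (w1 - w2)"
    and small: "norm (f w0) \<le> norm g * r / 2"
  shows "\<exists>!w. w \<in> cball w0 r \<and> f w = 0"
    and "w \<in> cball w0 r \<Longrightarrow> f w = 0 \<Longrightarrow> norm (w - w0) \<le> 2 * norm (f w0) / norm g"
proof -
  define T where "T w = w - f w / g" for w
  have g: "norm g > 0" using \<open>g \<noteq> 0\<close> by simp
  have contr: "dist (T w1) (T w2) \<le> 1 / 2 * dist w1 w2" if "w1 \<in> cball w0 r" "w2 \<in> cball w0 r" for w1 w2
  proof -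
    have "T w1 - T w2 = - (f w1 - f w2 - g * (w1 - w2)) / g"
      using \<open>g \<noteq> 0\<close> by (simp add: T_def field_simps)
    then have "norm (T w1 - T w2) = norm (f w1 - f w2 - g * (w1 - w2)) / norm g"
      by (simp add: norm_divide norm_minus_commute)
    also have "\<dots> \<le> norm g / 2 * norm (w1 - w2) / norm g"
      using lip[OF that] by (intro divide_right_mono) auto
    finally show ?thesis using g by (simp add: dist_norm)
  qed
  have T0: "dist (T w0) w0 \<le> r / 2"
    using small g by (simp add: T_def dist_norm norm_divide field_simps)
  have "T ` cball w0 r \<subseteq> cball w0 r"
  proof safe
    fix w assume w: "w \<in> cball w0 r"
    have "dist (T w) w0 \<le> dist (T w) (T w0) + dist (T w0) w0" by (rule dist_triangle)
    also have "\<dots> \<le> 1 / 2 * dist w w0 + r / 2" using contr[OF w, of w0] T0 \<open>r > 0\<close> by simp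
    also have "\<dots> \<le> r" using w by (simp add: dist_commute)
    finally show "T w \<in> cball w0 r" by (simp add: dist_commute)
  qed
  then have "\<exists>!w\<in>cball w0 r. T w = w"
    using \<open>r > 0\<close> contr by (intro Banach_fix[of _ "1 / 2"]) (auto simp: complete_eq_closed)
  moreover have "T w = w \<longleftrightarrow> f w = 0" for w using \<open>g \<noteq> 0\<close> by (simp add: T_def)
  ultimately show "\<exists>!w. w \<in> cball w0 r \<and> f w = 0" by simp
  assume w: "w \<in> cball w0 r" "f w = 0"
  have "norm g * norm (w - w0) - norm (f w0) \<le> norm (f w - f w0 - g * (w - w0))"
    using norm_triangle_ineq2[of "- (g * (w - w0))" "f w0"] w(2)
    by (simp add: norm_mult diff_diff_eq2 minus_diff_commute[of "f w0"])
  also have "\<dots> \<le> norm g / 2 * norm (w - w0)" using lip[OF w(1), of w0] \<open>r > 0\<close> by simp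
  finally show "norm (w - w0) \<le> 2 * norm (f w0) / norm g" using g by (simp add: field_simps)
qed

text \<open>With \<open>\<bar>\<delta>\<bar>\<close> in place of \<open>\<delta>\<close>, the members of the family are permittivities for every index.\<close>

lemma family_limits:
  fixes E :: "real \<Rightarrow> real \<Rightarrow> complex"
  assumes "\<mu> > 0" and perm: "\<forall>\<delta>\<ge>0. permittivity x0 (E \<delta>)"
    and re: "\<forall>\<delta>\<ge>0. \<forall>x. complex_of_real (Re (E \<delta> x)) = E 0 x"
    and im: "((\<lambda>\<delta>. SUP x. \<bar>Im (E \<delta> x)\<bar>) \<longlongrightarrow> 0) (at_right 0)"
    and gap: "norm (multiplier \<mu> x0 (E 0) (\<omega>\<^sup>2)) < 1"
  shows "((\<lambda>\<delta>. zeta \<mu> x0 (E \<bar>\<delta>\<bar>) (\<omega>\<^sup>2)) \<longlongrightarrow> zeta \<mu> x0 (E 0) (\<omega>\<^sup>2)) (at_right 0)"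
    and "((\<lambda>i. multiplier \<mu> x0 (E \<bar>fst i\<bar>) ((fst (snd i))\<^sup>2)) \<longlongrightarrow> multiplier \<mu> x0 (E 0) (\<omega>\<^sup>2))
           (at_right 0 \<times>\<^sub>F (nhds \<omega> \<times>\<^sub>F nhds \<omega>))"
    and "((\<lambda>i. multiplier \<mu> x0 (E \<bar>fst i\<bar>) ((snd (snd i))\<^sup>2)) \<longlongrightarrow> multiplier \<mu> x0 (E 0) (\<omega>\<^sup>2))
           (at_right 0 \<times>\<^sub>F (nhds \<omega> \<times>\<^sub>F nhds \<omega>))"
    and "((\<lambda>i. zeta_quot \<mu> x0 (E \<bar>fst i\<bar>) ((fst (snd i))\<^sup>2) ((snd (snd i))\<^sup>2)) \<longlongrightarrow>
           zeta_quot \<mu> x0 (E 0) (\<omega>\<^sup>2) (\<omega>\<^sup>2)) (at_right 0 \<times>\<^sub>F (nhds \<omega> \<times>\<^sub>F nhds \<omega>))"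
proof -
  \<comment> \<open>The filter \<open>nhds\<close> is not punctured, because either frequency may
    equal \<open>\<omega>\<close> itself.\<close>
  let ?F = "at_right (0::real) \<times>\<^sub>F (nhds \<omega> \<times>\<^sub>F nhds \<omega>)"
  define b where "b \<delta> = (SUP x. \<bar>Im (E \<bar>\<delta>\<bar> x)\<bar>)" for \<delta>
  have dist: "norm (E \<bar>\<delta>\<bar> x - E 0 x) \<le> b \<delta>" for \<delta> x
  proof -
    obtain C where C: "\<And>x. norm (E \<bar>\<delta>\<bar> x) \<le> C" using permittivity_bounded[of x0 "E \<bar>\<delta>\<bar>"] perm by auto
    \<comment> \<open>A real supremum is an upper bound only for sets that are bounded
      above.\<close>
    have "bdd_above (range (\<lambda>x. \<bar>Im (E \<bar>\<delta>\<bar> x)\<bar>))"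
      using order_trans[OF abs_Im_le_cmod C] by (intro bdd_aboveI[of _ C]) auto
    then have "\<bar>Im (E \<bar>\<delta>\<bar> x)\<bar> \<le> b \<delta>" unfolding b_def by (rule cSUP_upper[rotated]) simp
    moreover have "E \<bar>\<delta>\<bar> x - E 0 x = \<i> * of_real (Im (E \<bar>\<delta>\<bar> x))"
      unfolding re[rule_format, of "\<bar>\<delta>\<bar>" x, OF abs_ge_zero, symmetric] by (simp add: complex_eq_iff)
    ultimately show ?thesis by (simp add: norm_mult)
  qed
  have b: "(b \<longlongrightarrow> 0) (at_right 0)"
    using im
  proof (rule Lim_transform_eventually)
    show "\<forall>\<^sub>F \<delta> in at_right 0. (SUP x. \<bar>Im (E \<delta> x)\<bar>) = b \<delta>"
      using eventually_at_right_less[of "0::real"] by eventually_elim (simp add: b_def)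
  qed
  have b': "((\<lambda>i. b (fst i)) \<longlongrightarrow> 0) ?F"
    by (rule filterlim_compose[OF b filterlim_fst])
  have z1: "((\<lambda>i. (fst (snd i))\<^sup>2) \<longlongrightarrow> \<omega>\<^sup>2) ?F"
    by (intro tendsto_power filterlim_compose[OF filterlim_fst filterlim_snd])
  have z2: "((\<lambda>i. (snd (snd i))\<^sup>2) \<longlongrightarrow> \<omega>\<^sup>2) ?F"
    by (intro tendsto_power filterlim_compose[OF filterlim_snd filterlim_snd])
  have perm': "permittivity x0 (E \<bar>\<delta>\<bar>)" for \<delta> using perm by simp
  have perm0: "permittivity x0 (E 0)" using perm by simp
  have F: "?F \<noteq> bot" by (simp add: prod_filter_eq_bot)
  show "((\<lambda>\<delta>. zeta \<mu> x0 (E \<bar>\<delta>\<bar>) (\<omega>\<^sup>2)) \<longlongrightarrow> zeta \<mu> x0 (E 0) (\<omega>\<^sup>2)) (at_right 0)"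
    by (rule zeta_tendsto[OF perm0 perm' \<open>\<mu> > 0\<close> dist b tendsto_const gap])
  show "((\<lambda>i. multiplier \<mu> x0 (E \<bar>fst i\<bar>) ((fst (snd i))\<^sup>2)) \<longlongrightarrow> multiplier \<mu> x0 (E 0) (\<omega>\<^sup>2)) ?F"
    by (rule multiplier_tendsto[OF perm0 perm' \<open>\<mu> > 0\<close> dist b' z1 gap])
  show "((\<lambda>i. multiplier \<mu> x0 (E \<bar>fst i\<bar>) ((snd (snd i))\<^sup>2)) \<longlongrightarrow> multiplier \<mu> x0 (E 0) (\<omega>\<^sup>2)) ?F"
    by (rule multiplier_tendsto[OF perm0 perm' \<open>\<mu> > 0\<close> dist b' z2 gap])
  show "((\<lambda>i. zeta_quot \<mu> x0 (E \<bar>fst i\<bar>) ((fst (snd i))\<^sup>2) ((snd (snd i))\<^sup>2)) \<longlongrightarrow>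
           zeta_quot \<mu> x0 (E 0) (\<omega>\<^sup>2) (\<omega>\<^sup>2)) ?F"
    by (rule zeta_quot_tendsto[OF perm0 perm' \<open>\<mu> > 0\<close> dist b' z1 z2 gap F])
qed

text \<open>By \<open>zeta_Im\<close> both imaginary parts are negative multiples of
  \<open>Im (\<omega>\<^sup>2)\<close>, so they cancel only if it is zero. For real
  \<open>\<omega>\<^sup>2\<close> both quotients are negative, and their sum cannot vanish
  either.\<close>

lemma undamped_root_simple:
  assumes eA: "permittivity x0 eA" and eB: "permittivity x0 eB" and "\<mu> > 0"
    and real: "\<And>x. eA x \<in> \<real>" "\<And>x. eB x \<in> \<real>"
    and gap: "norm (multiplier \<mu> x0 eA (\<omega>\<^sup>2)) < 1" "norm (multiplier \<mu> x0 eB (\<omega>\<^sup>2)) < 1"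
    and root: "zeta \<mu> x0 eA (\<omega>\<^sup>2) + zeta \<mu> x0 eB (\<omega>\<^sup>2) = 0"
  shows "\<omega> * (zeta_quot \<mu> x0 eA (\<omega>\<^sup>2) (\<omega>\<^sup>2) + zeta_quot \<mu> x0 eB (\<omega>\<^sup>2) (\<omega>\<^sup>2)) \<noteq> 0"
proof -
  obtain p q where pq: "p > 0" "q > 0" "Im (zeta \<mu> x0 eA (\<omega>\<^sup>2)) = - p * Im (\<omega>\<^sup>2)"
    "Im (zeta \<mu> x0 eB (\<omega>\<^sup>2)) = - q * Im (\<omega>\<^sup>2)"
    using zeta_Im[OF eA \<open>\<mu> > 0\<close> real(1) gap(1)] zeta_Im[OF eB \<open>\<mu> > 0\<close> real(2) gap(2)] by metis
  have "Im (zeta \<mu> x0 eA (\<omega>\<^sup>2) + zeta \<mu> x0 eB (\<omega>\<^sup>2)) = 0" by (simp only: root zero_complex.sel)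
  then have "(p + q) * Im (\<omega>\<^sup>2) = 0" using pq(3,4) by (simp add: algebra_simps)
  then have "\<omega>\<^sup>2 \<in> \<real>" using pq(1,2) by (simp add: complex_is_Real_iff)
  then obtain r s where rs: "r > 0" "zeta_quot \<mu> x0 eA (\<omega>\<^sup>2) (\<omega>\<^sup>2) = - of_real r"
    "s > 0" "zeta_quot \<mu> x0 eB (\<omega>\<^sup>2) (\<omega>\<^sup>2) = - of_real s"
    using zeta_quot_negative[OF eA \<open>\<mu> > 0\<close> real(1) gap(1)]
      zeta_quot_negative[OF eB \<open>\<mu> > 0\<close> real(2) gap(2)] by metis
  have "zeta_quot \<mu> x0 eA (\<omega>\<^sup>2) (\<omega>\<^sup>2) + zeta_quot \<mu> x0 eB (\<omega>\<^sup>2) (\<omega>\<^sup>2) = - complex_of_real (r + s)"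
    by (simp add: rs)
  moreover have "complex_of_real (r + s) \<noteq> 0" using rs(1,3) by (simp only: of_real_eq_0_iff)
  moreover have "\<omega> \<noteq> 0" using gap(1) multiplier_0[OF eA, of \<mu>] by auto
  ultimately show ?thesis by (metis mult_eq_0_iff neg_equal_0_iff_equal)
qed

theorem theorem6p4:
  fixes \<mu>0 x0 :: real
    and \<epsilon>A \<epsilon>B :: "real \<Rightarrow> real \<Rightarrow> complex"
    and \<omega>U :: complex
  assumes "\<mu>0 > 0"
    and "\<And>\<delta>. \<delta> \<ge> 0 \<Longrightarrow> permittivity x0 (\<epsilon>A \<delta>)"
    and "\<And>\<delta>. \<delta> \<ge> 0 \<Longrightarrow> permittivity x0 (\<epsilon>B \<delta>)"
    and "\<And>x. \<epsilon>A 0 x \<in> \<real>"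
    and "\<And>x. \<epsilon>B 0 x \<in> \<real>"
    and "\<And>\<delta> x. \<delta> \<ge> 0 \<Longrightarrow> complex_of_real (Re (\<epsilon>A \<delta> x)) = \<epsilon>A 0 x"
    and "\<And>\<delta> x. \<delta> \<ge> 0 \<Longrightarrow> complex_of_real (Re (\<epsilon>B \<delta> x)) = \<epsilon>B 0 x"
    and "((\<lambda>\<delta>. SUP x. \<bar>Im (\<epsilon>A \<delta> x)\<bar>) \<longlongrightarrow> 0) (at_right 0)"
    and "((\<lambda>\<delta>. SUP x. \<bar>Im (\<epsilon>B \<delta> x)\<bar>) \<longlongrightarrow> 0) (at_right 0)"
    and "interface_impedance_root \<mu>0 x0 (\<epsilon>A 0) (\<epsilon>B 0) \<omega>U"
    and "\<omega>U \<in> common_band_gap \<mu>0 (\<epsilon>A 0) (\<epsilon>B 0)"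
    and "\<forall>\<^sub>F \<delta> in at_right 0. \<omega>U \<in> common_band_gap \<mu>0 (\<epsilon>A \<delta>) (\<epsilon>B \<delta>)"
  shows "(\<exists>\<omega>D :: real \<Rightarrow> complex.
            (\<forall>\<^sub>F \<delta> in at_right 0.
               \<omega>D \<delta> \<in> common_band_gap \<mu>0 (\<epsilon>A \<delta>) (\<epsilon>B \<delta>) \<and>
               interface_impedance_root \<mu>0 x0 (\<epsilon>A \<delta>) (\<epsilon>B \<delta>) (\<omega>D \<delta>)) \<and>
            (\<omega>D \<longlongrightarrow> \<omega>U) (at_right 0)) \<and>
         (\<forall>\<omega>1 \<omega>2 :: real \<Rightarrow> complex.
            (\<forall>\<^sub>F \<delta> in at_right 0.
               \<omega>1 \<delta> \<in> common_band_gap \<mu>0 (\<epsilon>A \<delta>) (\<epsilon>B \<delta>) \<and>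
               interface_impedance_root \<mu>0 x0 (\<epsilon>A \<delta>) (\<epsilon>B \<delta>) (\<omega>1 \<delta>)) \<longrightarrow>
            (\<omega>1 \<longlongrightarrow> \<omega>U) (at_right 0) \<longrightarrow>
            (\<forall>\<^sub>F \<delta> in at_right 0.
               \<omega>2 \<delta> \<in> common_band_gap \<mu>0 (\<epsilon>A \<delta>) (\<epsilon>B \<delta>) \<and>
               interface_impedance_root \<mu>0 x0 (\<epsilon>A \<delta>) (\<epsilon>B \<delta>) (\<omega>2 \<delta>)) \<longrightarrow>
            (\<omega>2 \<longlongrightarrow> \<omega>U) (at_right 0) \<longrightarrow>
            (\<forall>\<^sub>F \<delta> in at_right 0. \<omega>1 \<delta> = \<omega>2 \<delta>))"
proof -
  note \<mu> = assms(1) and permA = assms(2) and permB = assms(3)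
  have A0: "permittivity x0 (\<epsilon>A 0)" and B0: "permittivity x0 (\<epsilon>B 0)"
    using permA[of 0] permB[of 0] by simp_all
  have gap0: "norm (multiplier \<mu>0 x0 (\<epsilon>A 0) (\<omega>U\<^sup>2)) < 1" "norm (multiplier \<mu>0 x0 (\<epsilon>B 0) (\<omega>U\<^sup>2)) < 1"
    using assms(11) gap_iff[OF A0 B0 \<mu>] by auto
  have root0: "zeta \<mu>0 x0 (\<epsilon>A 0) (\<omega>U\<^sup>2) + zeta \<mu>0 x0 (\<epsilon>B 0) (\<omega>U\<^sup>2) = 0"
    using assms(10) interface_impedance_root_iff[OF A0 B0 \<mu> assms(11)] by simp
  define f where "f \<delta> w = zeta \<mu>0 x0 (\<epsilon>A \<bar>\<delta>\<bar>) (w\<^sup>2) + zeta \<mu>0 x0 (\<epsilon>B \<bar>\<delta>\<bar>) (w\<^sup>2)" for \<delta> w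
  define q where "q \<delta> w1 w2 = zeta_quot \<mu>0 x0 (\<epsilon>A \<bar>\<delta>\<bar>) (w1\<^sup>2) (w2\<^sup>2) +
    zeta_quot \<mu>0 x0 (\<epsilon>B \<bar>\<delta>\<bar>) (w1\<^sup>2) (w2\<^sup>2)" for \<delta> w1 w2
  define inside where "inside \<delta> w \<longleftrightarrow> norm (multiplier \<mu>0 x0 (\<epsilon>A \<bar>\<delta>\<bar>) (w\<^sup>2)) < 1 \<and>
    norm (multiplier \<mu>0 x0 (\<epsilon>B \<bar>\<delta>\<bar>) (w\<^sup>2)) < 1" for \<delta> w
  \<comment> \<open>The derivative of \<open>f 0\<close> at \<open>\<omega>U\<close>: by the chain
    rule for \<open>z = w^2\<close>, the diagonal value of \<open>q\<close> is multiplied by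
    \<open>2 * \<omega>U\<close>, written as the limit of \<open>w1 + w2\<close>.\<close>
  define g where "g = (\<omega>U + \<omega>U) * q 0 \<omega>U \<omega>U"
  have "\<omega>U * q 0 \<omega>U \<omega>U \<noteq> 0"
    using undamped_root_simple[OF A0 B0 \<mu> assms(4,5) gap0 root0] by (simp add: q_def)
  then have g: "g \<noteq> 0" by (simp add: g_def)
  have "\<forall>\<delta>\<ge>0. permittivity x0 (\<epsilon>A \<delta>)" "\<forall>\<delta>\<ge>0. \<forall>x. complex_of_real (Re (\<epsilon>A \<delta> x)) = \<epsilon>A 0 x"
    using permA assms(6) by simp_all
  note limA = family_limits[OF \<mu> this assms(8) gap0(1)]
  have "\<forall>\<delta>\<ge>0. permittivity x0 (\<epsilon>B \<delta>)" "\<forall>\<delta>\<ge>0. \<forall>x. complex_of_real (Re (\<epsilon>B \<delta> x)) = \<epsilon>B 0 x"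
    using permB assms(7) by simp_all
  note limB = family_limits[OF \<mu> this assms(9) gap0(2)]
  let ?F = "at_right (0::real) \<times>\<^sub>F (nhds \<omega>U \<times>\<^sub>F nhds \<omega>U)"
  \<comment> \<open>For distinct frequencies in the gap this is the divided difference of
    \<open>f \<delta>\<close>, as \<open>w1^2 - w2^2 = (w1 + w2) * (w1 - w2)\<close>.\<close>
  have "((\<lambda>i. (fst (snd i) + snd (snd i)) * q (fst i) (fst (snd i)) (snd (snd i))) \<longlongrightarrow> g) ?F"
    unfolding g_def q_def abs_zero
    by (intro tendsto_intros limA(4) limB(4) filterlim_compose[OF filterlim_fst filterlim_snd]
        filterlim_compose[OF filterlim_snd filterlim_snd])
  then have "\<forall>\<^sub>F i in ?F. dist ((fst (snd i) + snd (snd i)) * q (fst i) (fst (snd i)) (snd (snd i))) g < norm g / 2"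
    using g by (intro tendstoD) auto
  moreover have "\<forall>\<^sub>F i in ?F. inside (fst i) (fst (snd i)) \<and> inside (fst i) (snd (snd i))"
    unfolding inside_def
    using limA(2,3)[THEN tendsto_norm, THEN order_tendstoD(2), OF gap0(1)]
      limB(2,3)[THEN tendsto_norm, THEN order_tendstoD(2), OF gap0(2)]
    by eventually_elim simp
  ultimately have "\<forall>\<^sub>F i in ?F. inside (fst i) (fst (snd i)) \<and> inside (fst i) (snd (snd i)) \<and>
      dist ((fst (snd i) + snd (snd i)) * q (fst i) (fst (snd i)) (snd (snd i))) g < norm g / 2"
    by eventually_elim simp
  \<comment> \<open>Unpacking the product filter separates the condition \<open>P\<close> on
    \<open>\<delta>\<close> from the neighbourhood of \<open>\<omega>U\<close>; hence the radius
    \<open>r\<close> does not depend on \<open>\<delta>\<close>.\<close>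
  then obtain P Q where P: "\<forall>\<^sub>F \<delta> in at_right 0. P \<delta>" and Q: "eventually Q (nhds \<omega>U \<times>\<^sub>F nhds \<omega>U)"
    and PQ: "\<And>\<delta> w1 w2. P \<delta> \<Longrightarrow> Q (w1, w2) \<Longrightarrow> inside \<delta> w1 \<and> inside \<delta> w2 \<and>
      dist ((w1 + w2) * q \<delta> w1 w2) g < norm g / 2"
    unfolding eventually_prod_filter[of _ "at_right 0"] by auto
  obtain Q1 Q2 where Q12: "eventually Q1 (nhds \<omega>U)" "eventually Q2 (nhds \<omega>U)"
    "\<And>w1 w2. Q1 w1 \<Longrightarrow> Q2 w2 \<Longrightarrow> Q (w1, w2)"
    using Q unfolding eventually_prod_filter by blast
  have "\<forall>\<^sub>F w in nhds \<omega>U. Q1 w \<and> Q2 w" using Q12(1,2) by eventually_elim simp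
  then obtain d where d: "d > 0" "\<And>w. dist w \<omega>U < d \<Longrightarrow> Q1 w \<and> Q2 w"
    unfolding eventually_nhds_metric by blast
  \<comment> \<open>Half of \<open>d\<close>, so that the closed ball lies inside the open
    one.\<close>
  define r where "r = d / 2"
  have "r > 0" using d(1) by (simp add: r_def)
  have good: "inside \<delta> w1 \<and> inside \<delta> w2 \<and> dist ((w1 + w2) * q \<delta> w1 w2) g < norm g / 2"
    if "P \<delta>" "w1 \<in> cball \<omega>U r" "w2 \<in> cball \<omega>U r" for \<delta> w1 w2
    using that d by (intro PQ Q12(3)) (auto simp: r_def dist_commute)
  have lip: "norm (f \<delta> w1 - f \<delta> w2 - g * (w1 - w2)) \<le> norm g / 2 * norm (w1 - w2)"
    if *: "P \<delta>" "w1 \<in> cball \<omega>U r" "w2 \<in> cball \<omega>U r" for \<delta> w1 w2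
  proof -
    have ins: "inside \<delta> w1" "inside \<delta> w2" and dist: "dist ((w1 + w2) * q \<delta> w1 w2) g < norm g / 2"
      using good[OF *] by auto
    have "f \<delta> w1 - f \<delta> w2 = (w1\<^sup>2 - w2\<^sup>2) * q \<delta> w1 w2"
      using zeta_diff[OF permA, of "\<bar>\<delta>\<bar>" \<mu>0 "w1\<^sup>2" "w2\<^sup>2"] zeta_diff[OF permB, of "\<bar>\<delta>\<bar>" \<mu>0 "w1\<^sup>2" "w2\<^sup>2"] ins
      by (simp add: f_def q_def inside_def algebra_simps)
    then have "f \<delta> w1 - f \<delta> w2 - g * (w1 - w2) = ((w1 + w2) * q \<delta> w1 w2 - g) * (w1 - w2)"
      by (simp add: power2_eq_square algebra_simps)
    then show ?thesis
      using mult_right_mono[OF less_imp_le[OF dist[unfolded dist_norm]], of "norm (w1 - w2)"]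
      by (simp add: norm_mult)
  qed
  have f0: "((\<lambda>\<delta>. f \<delta> \<omega>U) \<longlongrightarrow> 0) (at_right 0)"
    using tendsto_add[OF limA(1) limB(1)] root0 by (simp add: f_def)
  have "\<forall>\<^sub>F \<delta> in at_right 0. norm (f \<delta> \<omega>U) < norm g * r / 2"
    using tendsto_norm[OF f0] g \<open>r > 0\<close> by (intro order_tendstoD(2)[of _ 0]) auto
  then have small: "\<forall>\<^sub>F \<delta> in at_right 0. \<delta> > 0 \<and> P \<delta> \<and> norm (f \<delta> \<omega>U) \<le> norm g * r / 2"
    using P eventually_at_right_less[of "0::real"] by eventually_elim simp
  \<comment> \<open>On the ball \<open>inside\<close> provides the gap condition, so roots of the
    impedance are exactly the zeros of \<open>f \<delta>\<close>; \<open>\<delta> > 0\<close>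
    removes the absolute value.\<close>
  have root_iff: "w \<in> common_band_gap \<mu>0 (\<epsilon>A \<delta>) (\<epsilon>B \<delta>) \<and>
      (interface_impedance_root \<mu>0 x0 (\<epsilon>A \<delta>) (\<epsilon>B \<delta>) w \<longleftrightarrow> f \<delta> w = 0)"
    if "\<delta> > 0" "P \<delta>" "w \<in> cball \<omega>U r" for \<delta> w
  proof -
    have perm: "permittivity x0 (\<epsilon>A \<delta>)" "permittivity x0 (\<epsilon>B \<delta>)" using permA permB that(1) by simp_all
    have gap: "w \<in> common_band_gap \<mu>0 (\<epsilon>A \<delta>) (\<epsilon>B \<delta>)"
      using good[OF that(2,3,3)] that(1) gap_iff[OF perm \<mu>] by (simp add: inside_def)
    then show ?thesis
      using interface_impedance_root_iff[OF perm \<mu> gap] that(1) by (simp add: f_def)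
  qed
  define \<omega>D where "\<omega>D \<delta> = (THE w. w \<in> cball \<omega>U r \<and> f \<delta> w = 0)" for \<delta>
  have \<omega>D: "\<omega>D \<delta> \<in> cball \<omega>U r \<and> f \<delta> (\<omega>D \<delta>) = 0"
    if "P \<delta>" "norm (f \<delta> \<omega>U) \<le> norm g * r / 2" for \<delta>
    unfolding \<omega>D_def
    by (rule theI'[OF simplified_newton_root(1)[OF g \<open>r > 0\<close> lip[OF that(1)] that(2)]])
  show ?thesis
  proof (intro conjI exI[of _ \<omega>D] allI impI)
    show "\<forall>\<^sub>F \<delta> in at_right 0. \<omega>D \<delta> \<in> common_band_gap \<mu>0 (\<epsilon>A \<delta>) (\<epsilon>B \<delta>) \<and>
        interface_impedance_root \<mu>0 x0 (\<epsilon>A \<delta>) (\<epsilon>B \<delta>) (\<omega>D \<delta>)"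
      using small by eventually_elim (use root_iff \<omega>D in blast)
    \<comment> \<open>The error bound for the root is proportional to
      \<open>norm (f \<delta> \<omega>U)\<close>, which tends to \<open>0\<close>.\<close>
    have "((\<lambda>\<delta>. 2 * norm (f \<delta> \<omega>U) / norm g) \<longlongrightarrow> 2 * norm (0::complex) / norm g) (at_right 0)"
      using g by (intro tendsto_intros f0) simp
    then have lim: "((\<lambda>\<delta>. 2 * norm (f \<delta> \<omega>U) / norm g) \<longlongrightarrow> 0) (at_right 0)" by simp
    have "\<forall>\<^sub>F \<delta> in at_right 0. norm (\<omega>D \<delta> - \<omega>U) \<le> 2 * norm (f \<delta> \<omega>U) / norm g"
      using small
      by eventually_elim
         (use simplified_newton_root(2)[OF g \<open>r > 0\<close> lip] \<omega>D in blast)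
    then have "((\<lambda>\<delta>. \<omega>D \<delta> - \<omega>U) \<longlongrightarrow> 0) (at_right 0)" using lim by (rule Lim_null_comparison)
    then show "(\<omega>D \<longlongrightarrow> \<omega>U) (at_right 0)" by (simp add: LIM_zero_iff)
  next
    \<comment> \<open>Convergence to \<open>\<omega>U\<close> brings both families into the fixed
      ball, where \<open>f \<delta>\<close> has a single zero.\<close>
    fix \<omega>1 \<omega>2 :: "real \<Rightarrow> complex"
    assume roots: "\<forall>\<^sub>F \<delta> in at_right 0. \<omega>1 \<delta> \<in> common_band_gap \<mu>0 (\<epsilon>A \<delta>) (\<epsilon>B \<delta>) \<and>
        interface_impedance_root \<mu>0 x0 (\<epsilon>A \<delta>) (\<epsilon>B \<delta>) (\<omega>1 \<delta>)"
      "\<forall>\<^sub>F \<delta> in at_right 0. \<omega>2 \<delta> \<in> common_band_gap \<mu>0 (\<epsilon>A \<delta>) (\<epsilon>B \<delta>) \<and>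
        interface_impedance_root \<mu>0 x0 (\<epsilon>A \<delta>) (\<epsilon>B \<delta>) (\<omega>2 \<delta>)"
      and lim: "(\<omega>1 \<longlongrightarrow> \<omega>U) (at_right 0)" "(\<omega>2 \<longlongrightarrow> \<omega>U) (at_right 0)"
    have "\<forall>\<^sub>F \<delta> in at_right 0. dist (\<omega>1 \<delta>) \<omega>U < r" "\<forall>\<^sub>F \<delta> in at_right 0. dist (\<omega>2 \<delta>) \<omega>U < r"
      using lim \<open>r > 0\<close> by (auto intro: tendstoD)
    then show "\<forall>\<^sub>F \<delta> in at_right 0. \<omega>1 \<delta> = \<omega>2 \<delta>"
      using roots small
    proof eventually_elim
      case (elim \<delta>)
      then have in_ball: "\<omega>1 \<delta> \<in> cball \<omega>U r" "\<omega>2 \<delta> \<in> cball \<omega>U r" by (auto simp: dist_commute)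
      then have "f \<delta> (\<omega>1 \<delta>) = 0" "f \<delta> (\<omega>2 \<delta>) = 0" using elim root_iff by blast+
      moreover have "\<exists>!w. w \<in> cball \<omega>U r \<and> f \<delta> w = 0"
        using elim by (intro simplified_newton_root(1)[OF g \<open>r > 0\<close>] lip) simp_all
      ultimately show ?case using in_ball by blast
    qed
  qed
qed

end
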